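(* Let $T_1$ and $T_2$ be trees with orders $m$ and $n$ and diameters $d_1$ and $d_2$, respectively, let $G=T_1\Box T_2$, $p=mn$ and $d=d_1+d_2$. Then $$ {\rm rn}(G) \geq \begin{cases} (p-1)(d+1)-2nL(T_1)-2mL(T_2)+1, & \text{if } |W(T_1)|=|W(T_2)|=1,\\ (p-1)d-2nL(T_1)-2mL(T_2), & \text{if } |W(T_1)|\cdot|W(T_2)|=2,\\ (p-1)(d-1)-2nL(T_1)-2mL(T_2)+1, & \text{if } |W(T_1)|=|W(T_2)|=2. \end{cases} $$ Moreover, equality holds in this bound if and only if there exists a feasible ordering $(z_0,z_1,\ldots,z_{p-1})$ of $V(G)$ such that: (a) $L(z_0)+L(z_{p-1})=1$ if $|W(G)|=1$, and $L(z_0)+L(z_{p-1})=0$ if $|W(G)|\geq 2$; (b) the mapping $f$ defined by $f(z_0)=0$ and $f(z_{i+1})=f(z_i)+d+1-L(z_i)-L(z_{i+1})-\delta(z_i,z_{i+1})$ for $0\le i\le p-2$ is a radio labeling of $G$.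
   Context: All graphs are finite, simple and connected; $d(u,v)$ is the distance and ${\rm diam}(G)$ the diameter. A radio labeling of $G$ is a map $f:V(G)\to\mathbb{Z}_{\ge 0}$ with $|f(u)-f(v)|\geq {\rm diam}(G)+1-d(u,v)$ for all distinct $u,v$; its span is $\max f-\min f$, and ${\rm rn}(G)$ is the minimum span of a radio labeling of $G$. For a graph $H$ and $v\in V(H)$, $w_H(v)=\sum_{u\in V(H)}d(u,v)$; a weight center is a vertex minimizing $w_H$, and $W(H)$ is the set of weight centers. A tree $T$ has one or two weight centers, and if two, they are adjacent. The level of $u\in V(T)$ is $L_T(u)=\min_{w\in W(T)}d(u,w)$, and the total level is $L(T)=\sum_{u\in V(T)}L_T(u)$. Root $T$ at its weight center(s): $u$ is an ancestor of $v$ if the unique path from $v$ to the weight center nearest to $v$ passes through $u$ (every vertex is its own ancestor). $\phi_T(u,v)=\max\{L_T(z): z \text{ a common ancestor of } u,v\}$ (taken to be $0$ if there is no common ancestor). $\delta_T(u,v)=1$ if $W(T)=\{w,w'\}$ has two elements and $u,v$ lie in different components of $T-ww'$; otherwise $\delta_T(u,v)=0$. For $G=T_1\Box T_2$ (Cartesian product) and $z=(x,y)$, $z_a=(x_a,y_a)$, $z_b=(x_b,y_b)$: $L(z)=L_{T_1}(x)+L_{T_2}(y)$, $\phi(z_a,z_b)=\phi_{T_1}(x_a,x_b)+\phi_{T_2}(y_a,y_b)$, $\delta(z_a,z_b)=\delta_{T_1}(x_a,x_b)+\delta_{T_2}(y_a,y_b)$. One has $W(G)=W(T_1)\times W(T_2)$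 and ${\rm diam}(G)=d_1+d_2$. Let $\xi=|W(T_1)|+|W(T_2)|-2$. Two vertices $z_a,z_b$ of $G$ are feasible if $\phi(z_a,z_b)=0$ and $\delta(z_a,z_b)=\xi$ (in the paper's terminology: they lie in different sectors when $|W(G)|=1$, opposite sectors when $|W(G)|=2$, separate sectors when $|W(G)|=4$); otherwise non-feasible. An ordering $(z_0,\ldots,z_{p-1})$ of $V(G)$ is feasible if $z_t,z_{t+1}$ are feasible for every $0\le t\le p-2$, except that when $|W(G)|=4$ and $t=p/2-1$ one instead requires $\phi(z_{p/2-1},z_{p/2})=0$ and $\delta(z_{p/2-1},z_{p/2})=1$ (opposite sectors).
   Formalization: The formal theorem assumes p = mn ≥ 2, i.e. T_1 and T_2 are not both a single vertex; for p = 1 the stated bound equals 1 while rn(K_1) = 0, so the claim fails there. *)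

theory Defs
  imports "Graph_Theory.Graph_Theory"
begin

text \<open>
  Finite simple graphs are rendered as \<^locale>\<open>pair_graph\<close>: finite, loop-free, symmetric digraphs
  whose arcs are pairs of vertices, so that an edge is a pair of opposite arcs.
\<close>

definition gdist :: "'a pair_pre_digraph \<Rightarrow> 'a \<Rightarrow> 'a \<Rightarrow> nat" where
  "gdist G u v = (LEAST k. \<exists>p. pre_digraph.awalk (with_proj G) u p v \<and> length p = k)"

definition gdiam :: "'a pair_pre_digraph \<Rightarrow> nat" where
  "gdiam G = Max {gdist G u v |u v. u \<in> pverts G \<and> v \<in> pverts G}"

text \<open>
  The predicate \<^const>\<open>tree\<close> of the library cannot be used: it forbids directed cycles of
  length 2, and those arise from every edge of a symmetric digraph.
  Library connectedness includes that the vertex set is nonempty.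
\<close>
definition is_tree :: "'a pair_pre_digraph \<Rightarrow> bool" where
  "is_tree G \<longleftrightarrow> pair_graph G \<and> Digraph_Component.connected (with_proj G) \<and>
     \<not> (\<exists>p. pre_digraph.cycle (with_proj G) p \<and> 3 \<le> length p)"

definition cart_prod :: "'a pair_pre_digraph \<Rightarrow> 'b pair_pre_digraph \<Rightarrow> ('a \<times> 'b) pair_pre_digraph" where
  "cart_prod G H = \<lparr> pverts = pverts G \<times> pverts H,
     parcs = {((x, y), (x', y')) |x y x' y'.
        x = x' \<and> x \<in> pverts G \<and> (y, y') \<in> parcs H \<or>
        (x, x') \<in> parcs G \<and> y = y' \<and> y \<in> pverts H} \<rparr>"

definition radio_labeling :: "'a pair_pre_digraph \<Rightarrow> ('a \<Rightarrow> nat) \<Rightarrow> bool" where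
  "radio_labeling G f \<longleftrightarrow> (\<forall>u\<in>pverts G. \<forall>v\<in>pverts G. u \<noteq> v \<longrightarrow>
     \<bar>int (f u) - int (f v)\<bar> \<ge> int (gdiam G) + 1 - int (gdist G u v))"

definition label_span :: "'a pair_pre_digraph \<Rightarrow> ('a \<Rightarrow> nat) \<Rightarrow> nat" where
  "label_span G f = Max (f ` pverts G) - Min (f ` pverts G)"

definition radio_number :: "'a pair_pre_digraph \<Rightarrow> nat" where
  "radio_number G = (LEAST k. \<exists>f. radio_labeling G f \<and> label_span G f = k)"

definition weight :: "'a pair_pre_digraph \<Rightarrow> 'a \<Rightarrow> nat" where
  "weight H v = (\<Sum>u\<in>pverts H. gdist H u v)"

definition weight_centers :: "'a pair_pre_digraph \<Rightarrow> 'a set" where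
  "weight_centers H = {v \<in> pverts H. \<forall>u\<in>pverts H. weight H v \<le> weight H u}"

definition level :: "'a pair_pre_digraph \<Rightarrow> 'a \<Rightarrow> nat" where
  "level T u = Min ((\<lambda>w. gdist T u w) ` weight_centers T)"

definition total_level :: "'a pair_pre_digraph \<Rightarrow> nat" where
  "total_level T = (\<Sum>u\<in>pverts T. level T u)"

text \<open>
  In a tree the nearest weight center \<open>w\<close> and the path \<open>p\<close> below are unique, so the existential
  quantifier means ``the''.
\<close>
definition ancestor :: "'a pair_pre_digraph \<Rightarrow> 'a \<Rightarrow> 'a \<Rightarrow> bool" where
  "ancestor T u v \<longleftrightarrow> (\<exists>w\<in>weight_centers T. gdist T v w = level T v \<and>
     (\<exists>p. pre_digraph.apath (with_proj T) v p w \<and> u \<in> set (pre_digraph.awalk_verts (with_proj T) v p)))"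

definition phi :: "'a pair_pre_digraph \<Rightarrow> 'a \<Rightarrow> 'a \<Rightarrow> nat" where
  "phi T u v = (if \<exists>z. ancestor T z u \<and> ancestor T z v
     then Max {level T z |z. ancestor T z u \<and> ancestor T z v} else 0)"

definition delete_edge :: "'a pair_pre_digraph \<Rightarrow> 'a \<Rightarrow> 'a \<Rightarrow> 'a pair_pre_digraph" where
  "delete_edge T w w' = \<lparr> pverts = pverts T, parcs = parcs T - {(w, w'), (w', w)} \<rparr>"

definition delta :: "'a pair_pre_digraph \<Rightarrow> 'a \<Rightarrow> 'a \<Rightarrow> nat" where
  "delta T u v = (if \<exists>w w'. w \<noteq> w' \<and> weight_centers T = {w, w'} \<and>
       \<not> reachable (with_proj (delete_edge T w w')) u v
     then 1 else 0)"

definition prod_level :: "'a pair_pre_digraph \<Rightarrow> 'b pair_pre_digraph \<Rightarrow> 'a \<times> 'b \<Rightarrow> nat" where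
  "prod_level T1 T2 z = level T1 (fst z) + level T2 (snd z)"

definition prod_phi :: "'a pair_pre_digraph \<Rightarrow> 'b pair_pre_digraph \<Rightarrow> 'a \<times> 'b \<Rightarrow> 'a \<times> 'b \<Rightarrow> nat" where
  "prod_phi T1 T2 za zb = phi T1 (fst za) (fst zb) + phi T2 (snd za) (snd zb)"

definition prod_delta :: "'a pair_pre_digraph \<Rightarrow> 'b pair_pre_digraph \<Rightarrow> 'a \<times> 'b \<Rightarrow> 'a \<times> 'b \<Rightarrow> nat" where
  "prod_delta T1 T2 za zb = delta T1 (fst za) (fst zb) + delta T2 (snd za) (snd zb)"

text \<open>
  Truncated subtraction is harmless in \<open>prod_xi\<close>, as every tree has at least one weight center.
\<close>
definition prod_xi :: "'a pair_pre_digraph \<Rightarrow> 'b pair_pre_digraph \<Rightarrow> nat" where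
  "prod_xi T1 T2 = card (weight_centers T1) + card (weight_centers T2) - 2"

definition feasible :: "'a pair_pre_digraph \<Rightarrow> 'b pair_pre_digraph \<Rightarrow> 'a \<times> 'b \<Rightarrow> 'a \<times> 'b \<Rightarrow> bool" where
  "feasible T1 T2 za zb \<longleftrightarrow> prod_phi T1 T2 za zb = 0 \<and> prod_delta T1 T2 za zb = prod_xi T1 T2"

text \<open>
  An ordering \<open>(z 0, \<dots>, z (p - 1))\<close> of the \<open>p\<close> vertices; the exceptional position
  \<open>t = p/2 - 1\<close> is written \<open>2 * (t + 1) = p\<close>.
\<close>
definition feasible_ordering :: "'a pair_pre_digraph \<Rightarrow> 'b pair_pre_digraph \<Rightarrow> (nat \<Rightarrow> 'a \<times> 'b) \<Rightarrow> bool" where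
  "feasible_ordering T1 T2 z \<longleftrightarrow>
     (let G = cart_prod T1 T2; p = card (pverts G) in
       bij_betw z {..<p} (pverts G) \<and>
       (\<forall>t. t + 1 < p \<longrightarrow>
          (if card (weight_centers G) = 4 \<and> 2 * (t + 1) = p
           then prod_phi T1 T2 (z t) (z (t + 1)) = 0 \<and> prod_delta T1 T2 (z t) (z (t + 1)) = 1
           else feasible T1 T2 (z t) (z (t + 1)))))"

end

theory Submission
  imports Defs
begin

text \<open>
  Deleting an edge of a tree separates its ends, so every geodesic between the two sides uses the
  edge. Hence paths in a tree are geodesics and any three vertices have a median, which gives
  \<open>d(u,v) = L(u) + L(v) - 2 \<phi>(u,v) + \<delta>(u,v)\<close>; this passes to the product by adding coordinates.
  Enumerating the vertices by increasing label and telescoping, the span is a constant plus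
  \<open>L(z\<^sub>0) + L(z\<^sub>p\<^sub>-\<^sub>1) + \<Sum> 2 \<phi> + \<Sum> (\<xi> - \<delta>)\<close> plus the slacks of the consecutive radio conditions. All
  terms are nonnegative. They cannot all vanish if there is only one weight center, since
  \<open>z\<^sub>0 \<noteq> z\<^sub>p\<^sub>-\<^sub>1\<close>, nor if there are four: the parity of \<open>\<delta>\<close> then tells apart two classes of vertices
  of size \<open>p/2\<close> each, and the ordering has to change class. If it does so only once, the change
  happens exactly in the middle.
\<close>

subsection \<open>Distances in connected graphs and Cartesian products\<close>

abbreviation (in pair_pre_digraph) D :: "'a \<Rightarrow> 'a \<Rightarrow> nat" where
  "D \<equiv> gdist G"

context pair_wf_digraph
begin

lemma gdist_le_length: "awalk u p v \<Longrightarrow> D u v \<le> length p"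
  unfolding gdist_def by (rule Least_le) auto

lemma gdist_awalkE:
  assumes "awalk u q v"
  obtains p where "awalk u p v" "length p = D u v"
proof -
  have "\<exists>p. awalk u p v \<and> length p = D u v"
    unfolding gdist_def by (rule LeastI_ex) (use assms in auto)
  then show ?thesis using that by blast
qed

text \<open>A potential argument. Since \<open>h\<close> drops by at most one along an arc, a walk
  from \<open>u\<close> to \<open>v\<close> has at least \<open>h u\<close> arcs; descending along
  arcs on which \<open>h\<close> drops by exactly one yields a walk with \<open>h u\<close>
  arcs.\<close>

lemma gdist_eqI:
  assumes u: "u \<in> pverts G" and v: "v \<in> pverts G" and zero: "h v = 0"
    and le: "\<And>x y. (x, y) \<in> parcs G \<Longrightarrow> h x \<le> Suc (h y)"
    and ex: "\<And>x. x \<in> pverts G \<Longrightarrow> x \<noteq> v \<Longrightarrow> \<exists>y. (x, y) \<in> parcs G \<and> h x = Suc (h y)"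
  shows "D u v = h u"
proof -
  have lower: "h x \<le> length p" if "awalk x p v" for x p
    using that
  proof (induction p arbitrary: x)
    case Nil
    then show ?case using zero by (auto simp: awalk_Nil_iff)
  next
    case (Cons e p)
    from Cons.prems have "(x, snd e) \<in> parcs G" "awalk (snd e) p v"
      by (auto simp: awalk_Cons_iff)
    then show ?case using le[of x "snd e"] Cons.IH[of "snd e"] by simp
  qed
  have "\<exists>p. awalk x p v \<and> length p = k" if "x \<in> pverts G" "h x = k" for x k
    using that
  proof (induction k arbitrary: x)
    case 0
    then have "x = v" using ex by force
    then show ?case using v by (auto simp: awalk_Nil_iff)
  next
    case (Suc k)
    then obtain y where y: "(x, y) \<in> parcs G" "h x = Suc (h y)"
      using ex zero by (metis Zero_not_Suc)
    then obtain p where "awalk y p v" "length p = k"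
      using Suc in_arcsD2 by (metis Suc_inject)
    then have "awalk x ((x, y) # p) v \<and> length ((x, y) # p) = Suc k"
      using y by (auto simp: awalk_Cons_iff)
    then show ?case by blast
  qed
  from this[OF u refl] obtain p where p: "awalk u p v" "length p = h u" by blast
  obtain q where "awalk u q v" "length q = D u v" using gdist_awalkE[OF p(1)] .
  with lower gdist_le_length[OF p(1)] p(2) show ?thesis by fastforce
qed

end

lemma length_rev_path: "length (rev_path p) = length p"
  by (induction p) auto

locale conn_graph = pair_graph +
  assumes vertex_exists: "pverts G \<noteq> {}"
    and all_reachable: "\<lbrakk>u \<in> pverts G; v \<in> pverts G\<rbrakk> \<Longrightarrow> reachable (with_proj G) u v"
begin

lemma shortest_awalkE:
  assumes "u \<in> pverts G" "v \<in> pverts G"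
  obtains p where "awalk u p v" "length p = D u v"
  using all_reachable[OF assms] gdist_awalkE unfolding reachable_awalk by blast

lemma gdist_self [simp]: "u \<in> pverts G \<Longrightarrow> D u u = 0"
  using gdist_le_length[of u "[]" u] by (simp add: awalk_Nil_iff)

lemma gdist_eq_0_iff: "\<lbrakk>u \<in> pverts G; v \<in> pverts G\<rbrakk> \<Longrightarrow> D u v = 0 \<longleftrightarrow> u = v"
proof
  assume V: "u \<in> pverts G" "v \<in> pverts G" and "D u v = 0"
  then obtain p where "awalk u p v" "length p = 0" using shortest_awalkE[OF V] by metis
  then show "u = v" by (simp add: awalk_Nil_iff)
qed simp

lemma gdist_triangle:
  assumes "u \<in> pverts G" "v \<in> pverts G" "w \<in> pverts G"
  shows "D u w \<le> D u v + D v w"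
proof -
  obtain p where p: "awalk u p v" "length p = D u v" using shortest_awalkE assms by blast
  obtain q where q: "awalk v q w" "length q = D v w" using shortest_awalkE assms by blast
  show ?thesis using gdist_le_length[OF awalk_appendI[OF p(1) q(1)]] p q by simp
qed

lemma gdist_commute:
  assumes "u \<in> pverts G" "v \<in> pverts G"
  shows "D u v = D v u"
proof -
  have "D x y \<le> D y x" if V: "x \<in> pverts G" "y \<in> pverts G" for x y
  proof -
    obtain p where p: "awalk y p x" "length p = D y x" using shortest_awalkE[OF V(2,1)] .
    then have "awalk x (rev_path p) y" by simp
    then show ?thesis using gdist_le_length p(2) length_rev_path by metis
  qed
  then show ?thesis using assms by (simp add: le_antisym)
qed

lemma gdist_arc: "(u, v) \<in> parcs G \<Longrightarrow> D u v = 1"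
proof -
  assume a: "(u, v) \<in> parcs G"
  then have "awalk u [(u, v)] v" by (auto simp: awalk_simps dest: in_arcsD2)
  from gdist_le_length[OF this] have "D u v \<le> 1" by simp
  moreover have "D u v \<noteq> 0"
    using a gdist_eq_0_iff[of u v] in_arcsD1[of u v] in_arcsD2[of u v] no_loops'[of u v] by simp
  ultimately show ?thesis by simp
qed

text \<open>The first arc of a shortest walk; by the triangle inequality the remainder is shortest
  as well.\<close>

lemma gdist_stepE:
  assumes "u \<in> pverts G" "v \<in> pverts G" "u \<noteq> v"
  obtains x where "(u, x) \<in> parcs G" "D u v = Suc (D x v)"
proof -
  obtain p where p: "awalk u p v" "length p = D u v" using shortest_awalkE assms by blast
  then obtain e q where "p = e # q" using assms(3) by (cases p) (auto simp: awalk_Nil_iff)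
  then have a: "(u, snd e) \<in> parcs G" "awalk (snd e) q v" "D u v = Suc (length q)"
    using p by (auto simp: awalk_Cons_iff)
  moreover have "D u v \<le> Suc (D (snd e) v)"
    using gdist_triangle[of u "snd e" v] gdist_arc a in_arcsD2 assms by force
  ultimately show ?thesis using that[of "snd e"] gdist_le_length[OF a(2)] by simp
qed

lemma gdist_le_gdiam:
  assumes "u \<in> pverts G" "v \<in> pverts G"
  shows "D u v \<le> gdiam G"
proof -
  have "finite {D u v |u v. u \<in> pverts G \<and> v \<in> pverts G}"
    using finite_image_set2[of "\<lambda>u. u \<in> pverts G" "\<lambda>u. u \<in> pverts G" D] by simp
  then show ?thesis unfolding gdiam_def using assms by (intro Max_ge) auto
qed

lemma gdiam_attained: "\<exists>u\<in>pverts G. \<exists>v\<in>pverts G. D u v = gdiam G"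
proof -
  have "finite {D u v |u v. u \<in> pverts G \<and> v \<in> pverts G}"
    using finite_image_set2[of "\<lambda>u. u \<in> pverts G" "\<lambda>u. u \<in> pverts G" D] by simp
  then have "gdiam G \<in> {D u v |u v. u \<in> pverts G \<and> v \<in> pverts G}"
    unfolding gdiam_def using vertex_exists by (intro Max_in) auto
  then obtain u v where "gdiam G = D u v" "u \<in> pverts G" "v \<in> pverts G" by blast
  then show ?thesis by metis
qed

end

section \<open>Distances and diameter in Cartesian products\<close>

lemma pair_wf_digraph_cart_prod:
  assumes "pair_wf_digraph G" "pair_wf_digraph H"
  shows "pair_wf_digraph (cart_prod G H)"
proof -
  interpret G: pair_wf_digraph G by fact
  interpret H: pair_wf_digraph H by fact
  show ?thesis
    by unfold_locales (auto simp: cart_prod_def dest: G.in_arcsD1 G.in_arcsD2 H.in_arcsD1 H.in_arcsD2)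
qed

text \<open>An arc of the product moves in exactly one coordinate, so the sum of the coordinate
  distances is a potential as required by \<open>gdist_eqI\<close>; it can be lowered in any
  coordinate that is not yet right.\<close>

lemma gdist_cart_prod:
  assumes "conn_graph G" "conn_graph H"
    and "x \<in> pverts G" "y \<in> pverts H" "x' \<in> pverts G" "y' \<in> pverts H"
  shows "gdist (cart_prod G H) (x, y) (x', y') = gdist G x x' + gdist H y y'"
proof -
  interpret G: conn_graph G by fact
  interpret H: conn_graph H by fact
  interpret P: pair_wf_digraph "cart_prod G H"
    by (rule pair_wf_digraph_cart_prod) unfold_locales
  let ?h = "\<lambda>z. G.D (fst z) x' + H.D (snd z) y'"
  have "P.D (x, y) (x', y') = ?h (x, y)"
  proof (rule P.gdist_eqI)
    fix z1 z2 assume "(z1, z2) \<in> parcs (cart_prod G H)"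
    then consider (1) a b b' where "z1 = (a, b)" "z2 = (a, b')" "a \<in> pverts G" "(b, b') \<in> parcs H"
      | (2) a a' b where "z1 = (a, b)" "z2 = (a', b)" "b \<in> pverts H" "(a, a') \<in> parcs G"
      by (auto simp: cart_prod_def)
    then show "?h z1 \<le> Suc (?h z2)"
    proof cases
      case 1
      then show ?thesis using H.gdist_triangle[of b b' y'] H.gdist_arc[of b b'] assms
        by (auto dest: H.in_arcsD1 H.in_arcsD2)
    next
      case 2
      then show ?thesis using G.gdist_triangle[of a a' x'] G.gdist_arc[of a a'] assms
        by (auto dest: G.in_arcsD1 G.in_arcsD2)
    qed
  next
    fix z assume z: "z \<in> pverts (cart_prod G H)" "z \<noteq> (x', y')"
    obtain a b where ab: "z = (a, b)" by fastforce
    with z have V: "a \<in> pverts G" "b \<in> pverts H" and ne: "a \<noteq> x' \<or> b \<noteq> y'"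
      by (auto simp: cart_prod_def)
    show "\<exists>z2. (z, z2) \<in> parcs (cart_prod G H) \<and> ?h z = Suc (?h z2)"
    proof (cases "a = x'")
      case True
      then obtain b' where "(b, b') \<in> parcs H" "H.D b y' = Suc (H.D b' y')"
        using H.gdist_stepE[of b y'] V ne assms by blast
      then show ?thesis using ab V by (intro exI[of _ "(a, b')"]) (auto simp: cart_prod_def)
    next
      case False
      then obtain a' where "(a, a') \<in> parcs G" "G.D a x' = Suc (G.D a' x')"
        using G.gdist_stepE[of a x'] V assms by blast
      then show ?thesis using ab V by (intro exI[of _ "(a', b)"]) (auto simp: cart_prod_def)
    qed
  qed (use assms in \<open>auto simp: cart_prod_def\<close>)
  then show ?thesis by simp
qed

text \<open>The coordinates of a pair of vertices vary independently, so the maximum of the sum is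
  the sum of the maxima.\<close>

lemma gdiam_cart_prod:
  assumes "conn_graph G" "conn_graph H"
  shows "gdiam (cart_prod G H) = gdiam G + gdiam H"
proof -
  interpret G: conn_graph G by fact
  interpret H: conn_graph H by fact
  let ?P = "cart_prod G H"
  let ?S = "{gdist ?P u v |u v. u \<in> pverts ?P \<and> v \<in> pverts ?P}"
  have S: "?S = {G.D x x' + H.D y y' |x x' y y'.
      x \<in> pverts G \<and> x' \<in> pverts G \<and> y \<in> pverts H \<and> y' \<in> pverts H}" (is "_ = ?R")
  proof (rule set_eqI, rule iffI)
    fix k assume "k \<in> ?S"
    then obtain u v where "k = gdist ?P u v" "u \<in> pverts G \<times> pverts H" "v \<in> pverts G \<times> pverts H"
      by (auto simp: cart_prod_def)
    moreover obtain x y x' y' where "u = (x, y)" "v = (x', y')" by fastforce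
    ultimately show "k \<in> ?R" using gdist_cart_prod[OF assms, of x y x' y'] by auto
  next
    fix k assume "k \<in> ?R"
    then obtain x x' y y' where k: "k = G.D x x' + H.D y y'" and V: "x \<in> pverts G" "y \<in> pverts H"
      "x' \<in> pverts G" "y' \<in> pverts H" by blast
    have "k = gdist ?P (x, y) (x', y')" using gdist_cart_prod[OF assms V] k by simp
    moreover have "(x, y) \<in> pverts ?P" "(x', y') \<in> pverts ?P" using V by (auto simp: cart_prod_def)
    ultimately show "k \<in> ?S" by blast
  qed
  have fin: "finite ?S"
    using finite_image_set2[of "\<lambda>u. u \<in> pverts ?P" "\<lambda>u. u \<in> pverts ?P" "gdist ?P"]
    by (simp add: cart_prod_def)
  show ?thesis unfolding gdiam_def[of ?P]
  proof (rule Max_eqI[OF fin])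
    show "gdiam G + gdiam H \<in> ?S"
      using G.gdiam_attained H.gdiam_attained unfolding S by (smt (verit) mem_Collect_eq)
  next
    fix k assume "k \<in> ?S"
    then show "k \<le> gdiam G + gdiam H"
      unfolding S by (auto intro!: add_mono G.gdist_le_gdiam H.gdist_le_gdiam)
  qed
qed

subsection \<open>Distances and weight centers in trees\<close>

locale pair_tree = conn_graph +
  assumes no_long_cycle: "cycle p \<Longrightarrow> length p < 3"
begin

abbreviation W :: "'a set" where
  "W \<equiv> weight_centers G"

section \<open>Deleting an edge of a tree\<close>

lemma delete_edge_commute: "delete_edge G x y = delete_edge G y x"
  by (auto simp: delete_edge_def)

lemma pair_sym_digraph_delete_edge: "pair_sym_digraph (delete_edge G x y)"
proof
  fix e assume "e \<in> parcs (delete_edge G x y)"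
  then show "fst e \<in> pverts (delete_edge G x y)" "snd e \<in> pverts (delete_edge G x y)"
    using in_arcsD1[of "fst e" "snd e"] in_arcsD2[of "fst e" "snd e"]
    by (auto simp: delete_edge_def)
next
  show "symmetric (with_proj (delete_edge G x y))"
    using arcs_symmetric by (auto simp: symmetric_def delete_edge_def intro!: symI)
qed

text \<open>A path from \<open>y\<close> to \<open>x\<close> that survives the deletion would close
  up with \<open>(x, y)\<close> to a cycle. It is not empty, and the only single arc it could be,
  \<open>(y, x)\<close>, has been deleted, so the cycle would have length at least 3.\<close>

lemma not_reachable_delete_edge:
  assumes "(x, y) \<in> parcs G"
  shows "\<not> reachable (with_proj (delete_edge G x y)) y x"
proof
  let ?H = "delete_edge G x y"
  interpret H: pair_sym_digraph ?H by (rule pair_sym_digraph_delete_edge)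
  assume "reachable (with_proj ?H) y x"
  then obtain q where q: "H.apath y q x" unfolding H.reachable_apath by blast
  then have w: "awalk y q x" and dist: "distinct (awalk_verts y q)" and sub: "set q \<subseteq> parcs ?H"
    unfolding H.apath_def H.awalk_def awalk_def by (auto simp: delete_edge_def)
  have "q \<noteq> []" using w no_loops'[OF assms] by (auto simp: awalk_Nil_iff)
  moreover have "q \<noteq> [e]" for e
    using w sub by (cases e) (auto simp: awalk_simps delete_edge_def)
  ultimately have "2 \<le> length q" by (cases q; cases "tl q") auto
  moreover have "cycle ((x, y) # q)"
    unfolding cycle_def using w dist assms by (intro exI[of _ x]) (auto simp: awalk_Cons_iff)
  ultimately show False using no_long_cycle by fastforce
qed

text \<open>Follow a walk from \<open>u\<close> to \<open>x\<close> in the whole tree: it survives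
  up to its first deleted arc, and a deleted arc starts at \<open>x\<close> or at
  \<open>y\<close>.\<close>

lemma reachable_delete_edge_cases:
  assumes "x \<in> pverts G" "u \<in> pverts G"
  shows "reachable (with_proj (delete_edge G x y)) u x \<or> reachable (with_proj (delete_edge G x y)) u y"
proof -
  let ?H = "delete_edge G x y"
  interpret H: pair_sym_digraph ?H by (rule pair_sym_digraph_delete_edge)
  have V: "pverts ?H = pverts G" by (simp add: delete_edge_def)
  show ?thesis using all_reachable[OF assms(2,1)]
  proof (induction rule: converse_reachable_induct)
    case base
    then show ?case using V by simp
  next
    case (step a b)
    then have ab: "a \<in> pverts G" "(a, b) \<in> parcs G" using in_arcsD1 by auto
    show ?case
    proof (cases "(a, b) \<in> parcs ?H")
      case True
      then show ?thesis using step.IH H.adj_reachable_trans by blast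
    next
      case False
      then have "a = x \<or> a = y" using ab by (auto simp: delete_edge_def)
      then show ?thesis using ab V by auto
    qed
  qed
qed

text \<open>The walk is split at its first deleted arc. Up to there it stays on the side of
  \<open>x\<close>, so this arc cannot start at \<open>y\<close> and must be
  \<open>(x, y)\<close>.\<close>

lemma awalk_across_edge:
  assumes arc: "(x, y) \<in> parcs G"
    and v: "reachable (with_proj (delete_edge G x y)) v y"
    and "awalk u p v" "reachable (with_proj (delete_edge G x y)) u x"
  shows "\<exists>p1 p2. p = p1 @ (x, y) # p2 \<and> awalk u p1 x \<and> awalk y p2 v"
proof -
  let ?H = "delete_edge G x y"
  interpret H: pair_sym_digraph ?H by (rule pair_sym_digraph_delete_edge)
  have bridge: "\<not> reachable (with_proj ?H) y x" using not_reachable_delete_edge[OF arc] .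
  show ?thesis using assms(3,4)
  proof (induction p arbitrary: u)
    case Nil
    then have "reachable (with_proj ?H) v x" by (auto simp: awalk_Nil_iff)
    then show ?case using bridge v H.symmetric_reachable' H.reachable_trans by blast
  next
    case (Cons e p)
    obtain b where e: "e = (u, b)" and ub: "(u, b) \<in> parcs G" and w: "awalk b p v"
      using Cons.prems(1) by (cases e) (auto simp: awalk_Cons_iff)
    show ?case
    proof (cases "(u, b) \<in> parcs ?H")
      case True
      then have "(b, u) \<in> parcs ?H" using H.arcs_symmetric by blast
      then have "reachable (with_proj ?H) b x" using Cons.prems(2) H.adj_reachable_trans by blast
      then obtain p1 p2 where "p = p1 @ (x, y) # p2" "awalk b p1 x" "awalk y p2 v"
        using Cons.IH[OF w] by blast
      then show ?thesis using e ub by (intro exI[of _ "e # p1"] exI[of _ p2]) (auto simp: awalk_Cons_iff)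
    next
      case False
      then have "(u, b) = (x, y) \<or> (u, b) = (y, x)" using ub by (auto simp: delete_edge_def)
      then have "u = x" "b = y" using Cons.prems(2) bridge by auto
      then show ?thesis using e w in_arcsD1[OF arc]
        by (intro exI[of _ "[]"] exI[of _ p]) (auto simp: awalk_Nil_iff)
    qed
  qed
qed

text \<open>A shortest walk has to use the edge, and its pieces before and after the edge bound the
  two distances on the right; the converse is the triangle inequality.\<close>

lemma gdist_across_edge:
  assumes arc: "(x, y) \<in> parcs G"
    and u: "reachable (with_proj (delete_edge G x y)) u x"
    and v: "reachable (with_proj (delete_edge G x y)) v y"
  shows "D u v = Suc (D u x + D y v)"
proof -
  let ?H = "delete_edge G x y"
  interpret H: pair_sym_digraph ?H by (rule pair_sym_digraph_delete_edge)
  have V: "pverts ?H = pverts G" by (simp add: delete_edge_def)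
  then have uv: "u \<in> pverts G" "v \<in> pverts G" using u v H.reachable_in_verts by auto
  note xy = in_arcsD1[OF arc] in_arcsD2[OF arc]
  obtain p where p: "awalk u p v" "length p = D u v" using shortest_awalkE[OF uv] .
  obtain p1 p2 where "p = p1 @ (x, y) # p2" "awalk u p1 x" "awalk y p2 v"
    using awalk_across_edge[OF arc v p(1) u] by blast
  then have "Suc (D u x + D y v) \<le> D u v"
    using gdist_le_length[of u p1 x] gdist_le_length[of y p2 v] p(2) by simp
  moreover have "D u v \<le> D u x + (1 + D y v)"
    using gdist_triangle[OF uv(1) xy(1) uv(2)] gdist_triangle[OF xy uv(2)] gdist_arc[OF arc] by simp
  ultimately show ?thesis by simp
qed

text \<open>This is \<open>gdist_across_edge\<close> with the opposite end of the edge as second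
  vertex. It allows the component of a vertex to be read off from its distances to \<open>x\<close>
  and \<open>y\<close>.\<close>

lemma reachable_delete_edge_iff:
  assumes arc: "(x, y) \<in> parcs G" and u: "u \<in> pverts G"
  shows "reachable (with_proj (delete_edge G x y)) u x \<longleftrightarrow> D u y = Suc (D u x)"
    and "reachable (with_proj (delete_edge G x y)) u y \<longleftrightarrow> D u x = Suc (D u y)"
proof -
  let ?H = "delete_edge G x y"
  interpret H: pair_sym_digraph ?H by (rule pair_sym_digraph_delete_edge)
  note xy = in_arcsD1[OF arc] in_arcsD2[OF arc]
  have "pverts ?H = pverts G" by (simp add: delete_edge_def)
  then have refl: "reachable (with_proj ?H) x x" "reachable (with_proj ?H) y y"
    using xy by simp_all
  have 1: "D u y = Suc (D u x)" if "reachable (with_proj ?H) u x"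
    using gdist_across_edge[OF arc that refl(2)] xy by simp
  have 2: "D u x = Suc (D u y)" if "reachable (with_proj ?H) u y"
    using gdist_across_edge[OF arcs_symmetric[OF arc], of u x] that refl(1) xy
    by (simp add: delete_edge_commute[of y x])
  show "reachable (with_proj ?H) u x \<longleftrightarrow> D u y = Suc (D u x)"
    and "reachable (with_proj ?H) u y \<longleftrightarrow> D u x = Suc (D u y)"
    using 1 2 reachable_delete_edge_cases[OF xy(1) u, of y] by (metis n_not_Suc_n Suc_n_not_le_n le_SucI order_refl)+
qed

text \<open>Bipartiteness of the tree: every vertex lies on one of the two sides of the edge, so
  ties are impossible.\<close>

lemma gdist_edge_cases:
  assumes "(x, y) \<in> parcs G" "u \<in> pverts G"
  shows "D u y = Suc (D u x) \<or> D u x = Suc (D u y)"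
  using reachable_delete_edge_iff[OF assms] reachable_delete_edge_cases in_arcsD1 assms by metis

lemma gdist_across_edge':
  assumes "(x, y) \<in> parcs G" "u \<in> pverts G" "v \<in> pverts G"
    and "D u x < D u y" "D v y < D v x"
  shows "D u v = Suc (D u x + D y v)"
proof (rule gdist_across_edge[OF assms(1)])
  have "D u y = Suc (D u x)" "D v x = Suc (D v y)"
    using gdist_edge_cases[OF assms(1,2)] gdist_edge_cases[OF assms(1,3)] assms(4,5) by linarith+
  then show "reachable (with_proj (delete_edge G x y)) u x" "reachable (with_proj (delete_edge G x y)) v y"
    using reachable_delete_edge_iff[OF assms(1)] assms(2,3) by blast+
qed

text \<open>Meant for \<open>delta\<close>, whose definition speaks of reachability after deleting
  the edge between the centers.\<close>

lemma reachable_delete_edge_iff_same_side: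
  assumes arc: "(x, y) \<in> parcs G" and u: "u \<in> pverts G" and v: "v \<in> pverts G"
  shows "reachable (with_proj (delete_edge G x y)) u v \<longleftrightarrow> (D u x < D u y \<longleftrightarrow> D v x < D v y)"
proof -
  let ?H = "delete_edge G x y"
  interpret H: pair_sym_digraph ?H by (rule pair_sym_digraph_delete_edge)
  have side: "D z x < D z y \<longleftrightarrow> reachable (with_proj ?H) z x" if "z \<in> pverts G" for z
    unfolding reachable_delete_edge_iff(1)[OF arc that] using gdist_edge_cases[OF arc that] by linarith
  have "reachable (with_proj ?H) u x \<or> reachable (with_proj ?H) u y"
    "reachable (with_proj ?H) v x \<or> reachable (with_proj ?H) v y"
    using reachable_delete_edge_cases[OF in_arcsD1[OF arc]] u v by blast+
  moreover have "\<not> reachable (with_proj ?H) y x" using not_reachable_delete_edge[OF arc] .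
  ultimately show ?thesis unfolding side[OF u] side[OF v]
    by (meson H.reachable_trans H.symmetric_reachable')
qed

section \<open>Paths, geodesics and medians\<close>

lemma shortest_awalk_apath:
  assumes "awalk u p v" "length p = D u v"
  shows "apath u p v"
proof (rule ccontr)
  assume "\<not> apath u p v"
  then have "\<not> distinct (awalk_verts u p)" using assms by (simp add: apath_def)
  from awalk_not_distinct_decomp[OF assms(1) this] obtain q r s where
    *: "p = q @ r @ s" "distinct (awalk_verts u q)" "0 < length r"
       "\<exists>w. awalk u q w \<and> awalk w r w \<and> awalk w s v" by blast
  then have "awalk u (q @ s) v" using awalk_appendI by blast
  then have "D u v \<le> length (q @ s)" by (rule gdist_le_length)
  then show False using *(1,3) assms(2) by (simp only: length_append)
qed

text \<open>If the first arc \<open>(u, x)\<close> led away from \<open>v\<close>, then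
  \<open>v\<close> would lie on the side of \<open>u\<close>, and the rest of the path, which starts
  at \<open>x\<close>, would have to cross the edge back to \<open>u\<close>, a vertex already
  visited. So every arc comes one closer to \<open>v\<close>.\<close>

lemma apath_shortest: "apath u p v \<Longrightarrow> length p = D u v"
proof (induction p arbitrary: u)
  case Nil
  then show ?case by (auto simp: apath_Nil_iff)
next
  case (Cons e p)
  obtain x where e: "e = (u, x)" and arc: "(u, x) \<in> parcs G" and ap: "apath x p v"
    and un: "u \<notin> set (awalk_verts x p)"
    using Cons.prems by (cases e) (auto simp: apath_Cons_iff)
  have w: "awalk x p v" using ap by (rule awalkI_apath)
  have V: "u \<in> pverts G" "x \<in> pverts G" "v \<in> pverts G"
    using in_arcsD1[OF arc] in_arcsD2[OF arc] w by auto
  have arc': "(x, u) \<in> parcs G" using arc by (rule arcs_symmetric)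
  have "D v u = Suc (D v x)"
  proof (rule ccontr)
    assume "D v u \<noteq> Suc (D v x)"
    then have "D v x = Suc (D v u)" using gdist_edge_cases[OF arc V(3)] by simp
    then have "reachable (with_proj (delete_edge G x u)) v u"
      using reachable_delete_edge_iff(2)[OF arc' V(3)] by simp
    moreover have "reachable (with_proj (delete_edge G x u)) x x"
      using reachable_delete_edge_iff(1)[OF arc' V(2)] gdist_arc[OF arc'] V by simp
    ultimately obtain p1 p2 where "p = p1 @ (x, u) # p2"
      using awalk_across_edge[OF arc' _ w] by blast
    then have "u \<in> set (awalk_verts x p)" using awalk_verts_arc2[OF w, of "(x, u)"] by simp
    then show False using un by simp
  qed
  then show ?case using Cons.IH[OF ap] e V by (simp add: gdist_commute)
qed

text \<open>Paths are geodesics and conversely, so lying on a path is equality in the triangle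
  inequality. This turns \<open>ancestor\<close> into a metric condition.\<close>

lemma on_apath_iff:
  assumes V: "v \<in> pverts G" "w \<in> pverts G"
  shows "(\<exists>p. apath v p w \<and> u \<in> set (awalk_verts v p)) \<longleftrightarrow> u \<in> pverts G \<and> D v u + D u w = D v w"
proof (intro iffI; elim exE conjE)
  fix p assume p: "apath v p w" "u \<in> set (awalk_verts v p)"
  have wk: "awalk v p w" using p(1) by (rule awalkI_apath)
  then have u: "u \<in> pverts G" using p(2) by auto
  obtain q r where qr: "p = q @ r" "awalk v q u" "awalk u r w"
    using awalk_decomp[OF wk p(2)] by blast
  have "D v u + D u w \<le> D v w"
    using gdist_le_length[OF qr(2)] gdist_le_length[OF qr(3)] apath_shortest[OF p(1)] qr(1) by simp
  then show "u \<in> pverts G \<and> D v u + D u w = D v w" using u gdist_triangle[OF V(1) u V(2)] by simp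
next
  assume u: "u \<in> pverts G" and eq: "D v u + D u w = D v w"
  obtain q where q: "awalk v q u" "length q = D v u" using shortest_awalkE[OF V(1) u] .
  obtain r where r: "awalk u r w" "length r = D u w" using shortest_awalkE[OF u V(2)] .
  have wk: "awalk v (q @ r) w" using q(1) r(1) by (rule awalk_appendI)
  then have "apath v (q @ r) w" using shortest_awalk_apath q(2) r(2) eq by simp
  moreover have "u \<in> set (awalk_verts v (q @ r))"
    using set_awalk_verts_append[of v q u r w] q r hd_in_awalk_verts(1)[OF r(1)] wk by auto
  ultimately show "\<exists>p. apath v p w \<and> u \<in> set (awalk_verts v p)" by blast
qed

text \<open>Induction on the distance from \<open>u\<close> to \<open>w\<close>, moving
  \<open>u\<close> along one arc to \<open>x\<close>, closer to \<open>w\<close>. If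
  \<open>v\<close> is on the side of \<open>u\<close>, then \<open>u\<close> itself is the median;
  otherwise this arc also leads towards \<open>v\<close>, and a median for \<open>x\<close> serves
  for \<open>u\<close>.\<close>

lemma median_exists:
  assumes "u \<in> pverts G" "v \<in> pverts G" "w \<in> pverts G"
  shows "\<exists>z\<in>pverts G. D u z + D z v = D u v \<and> D u z + D z w = D u w \<and> D v z + D z w = D v w"
  using assms(1)
proof (induction "D u w" arbitrary: u)
  case 0
  then show ?case using gdist_eq_0_iff assms by (intro bexI[of _ u]) auto
next
  case (Suc k)
  then have "u \<noteq> w" using assms by auto
  then obtain x where x: "(u, x) \<in> parcs G" "D u w = Suc (D x w)"
    using gdist_stepE Suc.prems assms by metis
  have V: "u \<in> pverts G" "x \<in> pverts G" using Suc.prems in_arcsD2[OF x(1)] by auto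
  have wx: "D w x < D w u" using x V assms by (simp add: gdist_commute)
  consider "D v u < D v x" | "D v u = Suc (D v x)"
    using gdist_edge_cases[OF x(1) assms(2)] by linarith
  then show ?case
  proof cases
    case 1
    have "D v w = Suc (D v u + D x w)"
      using gdist_across_edge'[OF x(1) assms(2,3) 1 wx] .
    then show ?thesis using V x(2) by (intro bexI[of _ u]) auto
  next
    case 2
    obtain z where z: "z \<in> pverts G" "D x z + D z v = D x v" "D x z + D z w = D x w" "D v z + D z w = D v w"
      using Suc.hyps(1)[of x] Suc.hyps(2) x(2) V by auto
    have "D u z \<le> Suc (D x z)" using gdist_triangle[OF V z(1)] gdist_arc[OF x(1)] by simp
    moreover have "D u v = Suc (D x v)" using 2 V assms by (simp add: gdist_commute)
    moreover have "D u v \<le> D u z + D z v" "D u w \<le> D u z + D z w"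
      using gdist_triangle V assms z(1) by auto
    ultimately show ?thesis using z x(2) by (intro bexI[of _ z]) auto
  qed
qed

section \<open>Weights and weight centers\<close>

text \<open>Across an edge every summand of the weight changes by exactly one, up or down according
  to the side of the vertex. Adding a cardinality on either side avoids subtraction of
  naturals.\<close>

lemma weight_edge:
  assumes arc: "(x, y) \<in> parcs G"
  shows "weight G y + card {u \<in> pverts G. D u y < D u x} = weight G x + card {u \<in> pverts G. D u x < D u y}"
proof -
  have cardsum: "card {u \<in> pverts G. P u} = (\<Sum>u\<in>pverts G. if P u then 1 else 0)" for P
    by (simp add: sum.inter_filter[symmetric] pair_finite_verts)
  have "D u y + (if D u y < D u x then 1 else 0) = D u x + (if D u x < D u y then 1 else 0)"
    if "u \<in> pverts G" for u
    using gdist_edge_cases[OF arc that] by auto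
  then show ?thesis
    unfolding cardsum weight_def sum.distrib[symmetric] by (intro sum.cong) auto
qed

lemma card_two_sides:
  assumes arc: "(x, y) \<in> parcs G"
  shows "card {u \<in> pverts G. D u x < D u y} + card {u \<in> pverts G. D u y < D u x} = card (pverts G)"
proof -
  have "{u \<in> pverts G. D u x < D u y} \<union> {u \<in> pverts G. D u y < D u x} = pverts G"
    using gdist_edge_cases[OF arc] by force
  then show ?thesis
    using card_Un_disjoint[of "{u \<in> pverts G. D u x < D u y}" "{u \<in> pverts G. D u y < D u x}"]
      pair_finite_verts by fastforce
qed

text \<open>If fewer than half of the vertices were on the side of \<open>w\<close>, moving from
  \<open>w\<close> to \<open>x\<close> would lower the weight.\<close>

lemma weight_center_side:
  assumes w: "w \<in> W" and arc: "(w, x) \<in> parcs G"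
  shows "card (pverts G) \<le> 2 * card {u \<in> pverts G. D u w < D u x}"
proof -
  have "weight G w \<le> weight G x" using w in_arcsD2[OF arc] by (simp add: weight_centers_def)
  then show ?thesis using weight_edge[OF arc] card_two_sides[OF arc] by simp
qed

lemma W_subset: "W \<subseteq> pverts G"
  by (auto simp: weight_centers_def)

lemma finite_W [simp]: "finite W"
  using finite_subset[OF W_subset pair_finite_verts] .

lemma W_nonempty: "W \<noteq> {}"
proof -
  have "Min (weight G ` pverts G) \<in> weight G ` pverts G"
    using vertex_exists pair_finite_verts by (intro Min_in) auto
  then obtain v where "v \<in> pverts G" "weight G v = Min (weight G ` pverts G)" by fastforce
  then have "v \<in> pverts G" "\<forall>u\<in>pverts G. weight G v \<le> weight G u"
    using pair_finite_verts by auto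
  then show ?thesis by (auto simp: weight_centers_def)
qed

text \<open>Take the first arcs of geodesics between the two centers, in both directions. The
  vertices behind \<open>w\<close> and those behind \<open>w'\<close> form disjoint sets, each with
  at least half of all vertices, so no vertex is left strictly between the centers.\<close>

lemma weight_centers_adjacent:
  assumes w: "w \<in> W" and w': "w' \<in> W" and ne: "w \<noteq> w'"
  shows "(w, w') \<in> parcs G"
proof -
  have V: "w \<in> pverts G" "w' \<in> pverts G" using w w' W_subset by auto
  obtain x where x: "(w, x) \<in> parcs G" "D w w' = Suc (D x w')" using gdist_stepE[OF V ne] .
  obtain y where y: "(w', y) \<in> parcs G" "D w' w = Suc (D y w)" using gdist_stepE[OF V(2,1)] ne by metis
  have Vx: "x \<in> pverts G" and Vy: "y \<in> pverts G" using in_arcsD2 x y by auto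
  let ?A = "{u \<in> pverts G. D u w < D u x}" and ?B = "{u \<in> pverts G. D u w' < D u y}"
  \<comment> \<open>A geodesic from \<open>?A\<close> to \<open>w'\<close> passes through the arc
    \<open>(w, x)\<close>, hence through \<open>w\<close>.\<close>
  have A: "D u w' = D u w + D w w'" if "u \<in> ?A" for u
    using gdist_across_edge'[OF x(1), of u w'] that x(2) V Vx by (simp add: gdist_commute)
  have B: "D u w = D u w' + D w w'" if "u \<in> ?B" for u
    using gdist_across_edge'[OF y(1), of u w] that y(2) V Vy by (simp add: gdist_commute)
  have pos: "0 < D w w'" using x(2) by simp
  have "?A \<inter> ?B = {}"
  proof (rule ccontr)
    assume "?A \<inter> ?B \<noteq> {}"
    then obtain u where "u \<in> ?A" "u \<in> ?B" by blast
    from A[OF this(1)] B[OF this(2)] pos show False by simp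
  qed
  then have "card (?A \<union> ?B) = card ?A + card ?B"
    using pair_finite_verts by (intro card_Un_disjoint) auto
  also have "\<dots> \<ge> card (pverts G)"
    using weight_center_side[OF w x(1)] weight_center_side[OF w' y(1)] by simp
  finally have "?A \<union> ?B = pverts G"
    using card_seteq[OF pair_finite_verts, of "?A \<union> ?B"] by auto
  \<comment> \<open>The neighbour \<open>x\<close> of \<open>w\<close> must be behind
    \<open>w'\<close>, which leaves only distance 1 between the centers.\<close>
  then have "x \<in> ?A \<or> x \<in> ?B" using Vx by blast
  moreover have "x \<notin> ?A" using Vx by simp
  ultimately have "D x w = D x w' + D w w'" using B by blast
  then have "D w w' = 1" using x(2) gdist_arc[OF arcs_symmetric[OF x(1)]] by simp
  then have "D x w' = 0" using x(2) by simp
  then have "x = w'" using gdist_eq_0_iff[OF Vx V(2)] by simp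
  then show ?thesis using x(1) by simp
qed

text \<open>A third center would be adjacent to the other two, hence equally far from both ends of
  an edge.\<close>

lemma W_cases:
  obtains (one) w where "W = {w}" "w \<in> pverts G"
  | (two) w w' where "W = {w, w'}" "w \<noteq> w'" "(w, w') \<in> parcs G" "w \<in> pverts G" "w' \<in> pverts G"
proof -
  obtain w where w: "w \<in> W" using W_nonempty by blast
  show ?thesis
  proof (cases "W = {w}")
    case True
    then show ?thesis using w W_subset one by blast
  next
    case False
    then obtain w' where w': "w' \<in> W" "w' \<noteq> w" using w by blast
    have "W = {w, w'}"
    proof (rule ccontr)
      assume "W \<noteq> {w, w'}"
      then obtain c where c: "c \<in> W" "c \<noteq> w" "c \<noteq> w'" using w w' by blast
      have "D c w = 1" "D c w' = 1" "(w, w') \<in> parcs G"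
        using weight_centers_adjacent c w w' gdist_arc by auto
      then show False using gdist_edge_cases[of w w' c] c W_subset by auto
    qed
    then show ?thesis using two w w' weight_centers_adjacent W_subset by blast
  qed
qed

section \<open>Levels, ancestors and the distance formula\<close>

lemma level_le: "w \<in> W \<Longrightarrow> level G u \<le> D u w"
  unfolding level_def by simp

lemma level_attained: "\<exists>w\<in>W. D u w = level G u"
proof -
  have "level G u \<in> (\<lambda>w. D u w) ` W"
    unfolding level_def using W_nonempty by (intro Min_in) auto
  then show ?thesis by auto
qed

lemma level_eq_0_iff: "u \<in> pverts G \<Longrightarrow> level G u = 0 \<longleftrightarrow> u \<in> W"
proof
  assume u: "u \<in> pverts G" "level G u = 0"
  obtain w where "w \<in> W" "D u w = 0" using level_attained[of u] u(2) by auto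
  then show "u \<in> W" using gdist_eq_0_iff[of u w] u(1) W_subset by auto
next
  assume "u \<in> pverts G" "u \<in> W"
  then show "level G u = 0" using level_le[of u u] by simp
qed

lemma ancestor_iff:
  assumes "v \<in> pverts G"
  shows "ancestor G z v \<longleftrightarrow>
    z \<in> pverts G \<and> (\<exists>w\<in>W. D v w = level G v \<and> D v z + D z w = D v w)"
  unfolding ancestor_def awalk_verts_with_proj_eq
  using on_apath_iff[OF assms, of _ z] W_subset by blast

text \<open>A center closer to \<open>z\<close> than \<open>w\<close> would, by way of
  \<open>z\<close>, also be closer to \<open>v\<close>.\<close>

lemma level_ancestor:
  assumes v: "v \<in> pverts G" and z: "z \<in> pverts G" and w: "w \<in> W" "D v w = level G v"
    and eq: "D v z + D z w = D v w"
  shows "level G z = D z w"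
proof -
  obtain c where c: "c \<in> W" "D z c = level G z" using level_attained by blast
  have "D v w \<le> D v c" using w(2) level_le[OF c(1)] by simp
  also have "\<dots> \<le> D v z + D z c" using gdist_triangle v z c(1) W_subset by blast
  finally show ?thesis using eq c level_le[OF w(1), of z] by simp
qed

text \<open>When \<open>w\<close> is the only nearest center of both vertices, their common
  ancestors are the vertices on both geodesics to \<open>w\<close>. The one of largest level is the
  median of \<open>u\<close>, \<open>v\<close> and \<open>w\<close>.\<close>

lemma gdist_phi_same_root:
  assumes V: "u \<in> pverts G" "v \<in> pverts G"
    and w: "w \<in> W" and u: "\<And>c. c \<in> W \<Longrightarrow> D u c = level G u \<longleftrightarrow> c = w"
    and v: "\<And>c. c \<in> W \<Longrightarrow> D v c = level G v \<longleftrightarrow> c = w"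
  shows "D u v + 2 * phi G u v = level G u + level G v"
proof -
  have wV: "w \<in> pverts G" using w W_subset by blast
  have uw: "D u w = level G u" and vw: "D v w = level G v" using u v w by auto
  have anc: "ancestor G z u \<longleftrightarrow> z \<in> pverts G \<and> D u z + D z w = D u w"
    "ancestor G z v \<longleftrightarrow> z \<in> pverts G \<and> D v z + D z w = D v w" for z
    using ancestor_iff V u v w by blast+
  obtain z where z: "z \<in> pverts G" "D u z + D z v = D u v" "D u z + D z w = D u w" "D v z + D z w = D v w"
    using median_exists[OF V wV] by blast
  let ?S = "{level G z |z. ancestor G z u \<and> ancestor G z v}"
  have "phi G u v = Max ?S" using z anc unfolding phi_def by auto
  also have "Max ?S = D z w"
  proof (rule Max_eqI)
    have "?S \<subseteq> level G ` pverts G" using anc by auto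
    then show "finite ?S" using finite_subset pair_finite_verts by blast
    show "D z w \<in> ?S" using level_ancestor[OF V(1) z(1) w uw z(3)] anc z by force
  next
    fix k assume "k \<in> ?S"
    then obtain y where y: "k = level G y" "y \<in> pverts G" "D u y + D y w = D u w" "D v y + D y w = D v w"
      using anc by auto
    have "k = D y w" using level_ancestor[OF V(1) y(2) w uw y(3)] y(1) by simp
    \<comment> \<open>A common ancestor gives a detour from \<open>u\<close> to \<open>v\<close>,
      shorter the higher its level; through the median the detour is already a geodesic.\<close>
    moreover have "D u v \<le> D u y + D v y"
      using gdist_triangle[OF V(1) y(2) V(2)] gdist_commute[OF y(2) V(2)] by simp
    ultimately show "k \<le> D z w" using y(3,4) z(2-4) gdist_commute[OF z(1) V(2)] by simp
  qed
  finally show ?thesis using z(2-4) gdist_commute[OF z(1) V(2)] uw vw by simp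
qed

lemma delta_one_center: "W = {w} \<Longrightarrow> delta G u v = 0"
  unfolding delta_def by auto

text \<open>The centers bound in \<open>delta_def\<close> may come in either order, but the deleted
  edge is the same.\<close>

lemma delta_two_centers:
  assumes "W = {w, w'}" "w \<noteq> w'" "(w, w') \<in> parcs G" "u \<in> pverts G" "v \<in> pverts G"
  shows "delta G u v = (if D u w < D u w' \<longleftrightarrow> D v w < D v w' then 0 else 1)"
proof -
  have "delete_edge G x y = delete_edge G w w'" if "W = {x, y}" for x y
    using that assms(1) delete_edge_commute[of w w'] by (auto simp: doubleton_eq_iff)
  then have "(\<exists>x y. x \<noteq> y \<and> W = {x, y} \<and> \<not> reachable (with_proj (delete_edge G x y)) u v)
    \<longleftrightarrow> \<not> reachable (with_proj (delete_edge G w w')) u v"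
    using assms(1,2) by metis
  then show ?thesis
    unfolding delta_def using reachable_delete_edge_iff_same_side[OF assms(3-5)] by simp
qed

lemma level_two_centers:
  assumes W: "W = {w, w'}" and u: "D u w < D u w'"
  shows "level G u = D u w" "c \<in> W \<Longrightarrow> D u c = level G u \<longleftrightarrow> c = w"
proof -
  show "level G u = D u w" using level_attained[of u] level_le[of w u] W u by auto
  then show "c \<in> W \<Longrightarrow> D u c = level G u \<longleftrightarrow> c = w" using W u by auto
qed

text \<open>A common ancestor would lie on the geodesics from \<open>u\<close> to \<open>w\<close>
  and from \<open>v\<close> to \<open>w'\<close>, and would thus be strictly closer to each center
  than to the other. So there is none, and \<open>phi\<close> takes its default value 0.\<close>

lemma phi_different_sides:
  assumes W: "W = {w, w'}"
    and u: "u \<in> pverts G" "D u w < D u w'" and v: "v \<in> pverts G" "D v w' < D v w"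
  shows "phi G u v = 0"
proof -
  have V: "w \<in> pverts G" "w' \<in> pverts G" using W W_subset by auto
  have "\<not> (ancestor G z u \<and> ancestor G z v)" for z
  proof
    assume "ancestor G z u \<and> ancestor G z v"
    then have z: "z \<in> pverts G" and zu: "D u z + D z w = D u w" and zv: "D v z + D z w' = D v w'"
      using ancestor_iff[OF u(1)] ancestor_iff[OF v(1)] level_two_centers[OF W u(2)]
        level_two_centers[OF _ v(2)] W by (auto simp: insert_commute)
    have "D u w' \<le> D u z + D z w'" "D v w \<le> D v z + D z w"
      using gdist_triangle z V u v by auto
    then show False using zu zv u(2) v(2) by simp
  qed
  then have "(\<exists>z. ancestor G z u \<and> ancestor G z v) = False" by blast
  then show ?thesis unfolding phi_def by (simp only: if_False)
qed

lemma gdist_different_sides: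
  assumes W: "W = {w, w'}" and arc: "(w, w') \<in> parcs G"
    and u: "u \<in> pverts G" "D u w < D u w'" and v: "v \<in> pverts G" "D v w' < D v w"
  shows "D u v + 2 * phi G u v = level G u + level G v + 1"
proof -
  have "level G u = D u w" using level_two_centers(1)[OF W u(2)] .
  moreover have "level G v = D v w'"
    using level_two_centers(1)[OF _ v(2)] W by (simp add: insert_commute)
  moreover have "D v w' = D w' v" using gdist_commute v in_arcsD2[OF arc] by simp
  ultimately show ?thesis
    using gdist_across_edge'[OF arc u(1) v(1) u(2) v(2)] phi_different_sides[OF W u v] by simp
qed

text \<open>With one center, or with both vertices on the same side, the median argument applies. On
  different sides the edge between the centers contributes the additional one, which is
  \<open>delta\<close>.\<close>

theorem gdist_phi:
  assumes u: "u \<in> pverts G" and v: "v \<in> pverts G"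
  shows "D u v + 2 * phi G u v = level G u + level G v + delta G u v"
proof (cases rule: W_cases)
  case (one w)
  have "level G x = D x w" for x using one by (simp add: level_def)
  then show ?thesis using gdist_phi_same_root[OF u v, of w] delta_one_center[OF one(1)] one by simp
next
  case (two w w')
  note W = two(1) and W' = two(1)[THEN trans, OF insert_commute]
  note arc = two(3) and arc' = arcs_symmetric[OF two(3)]
  note d = delta_two_centers[OF two(1-3) u v]
  have side: "D x w < D x w' \<or> D x w' < D x w" if "x \<in> pverts G" for x
    using gdist_edge_cases[OF arc that] by auto
  consider (11) "D u w < D u w'" "D v w < D v w'" | (12) "D u w < D u w'" "D v w' < D v w"
    | (21) "D u w' < D u w" "D v w < D v w'" | (22) "D u w' < D u w" "D v w' < D v w"
    using side u v by blast
  then show ?thesis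
  proof cases
    case 11
    then show ?thesis
      using gdist_phi_same_root[OF u v, of w] level_two_centers(2)[OF W] u v d W by auto
  next
    case 12
    then show ?thesis using gdist_different_sides[OF W arc u _ v] d by simp
  next
    case 21
    then show ?thesis using gdist_different_sides[OF W' arc' u _ v] d by simp
  next
    case 22
    then show ?thesis
      using gdist_phi_same_root[OF u v, of w'] level_two_centers(2)[OF W'] u v d W by auto
  qed
qed

lemma card_W: "card W = 1 \<or> card W = 2"
  by (cases rule: W_cases) auto

lemma delta_eq_0: "card W = 1 \<Longrightarrow> delta G u v = 0"
  using delta_one_center by (metis card_1_singletonE)

text \<open>Both centers have the same weight, so by \<open>weight_edge\<close> the two sides of the
  edge joining them are equally large.\<close>

lemma delta_bipartition:
  assumes "card W = 2"
  obtains A where "A \<subseteq> pverts G" "2 * card A = card (pverts G)"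
    "\<And>u v. u \<in> pverts G \<Longrightarrow> v \<in> pverts G \<Longrightarrow> delta G u v = (if u \<in> A \<longleftrightarrow> v \<in> A then 0 else 1)"
proof (cases rule: W_cases)
  case (one w)
  then show ?thesis using assms by simp
next
  case (two w w')
  let ?A = "{u \<in> pverts G. D u w < D u w'}"
  have "weight G w = weight G w'"
    using two by (auto simp: weight_centers_def intro!: le_antisym)
  then have "2 * card ?A = card (pverts G)"
    using weight_edge[OF two(3)] card_two_sides[OF two(3)] by simp
  then show ?thesis using that[of ?A] delta_two_centers[OF two(1-3)] by auto
qed

end

text \<open>In a symmetric digraph connectedness is strong connectedness, which gives reachability
  in both directions.\<close>

lemma is_tree_imp_pair_tree:
  assumes "is_tree T"
  shows "pair_tree T"
proof -
  interpret pair_graph T using assms by (simp add: is_tree_def)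
  have "strongly_connected (with_proj T)"
    using symmetric_connected_imp_strongly_connected[OF sym_arcs] assms by (simp add: is_tree_def)
  then show ?thesis
    using assms by unfold_locales (auto simp: strongly_connected_def is_tree_def not_le)
qed

subsection \<open>Radio labelings of products of trees\<close>

lemma bij_betw_sorted_enumeration:
  fixes f :: "'a \<Rightarrow> nat"
  assumes "finite V" "inj_on f V"
  obtains z where "bij_betw z {..<card V} V" "\<And>i. Suc i < card V \<Longrightarrow> f (z i) < f (z (Suc i))"
proof -
  let ?e = "enumerate (f ` V)" and ?g = "the_inv_into V f"
  have fin: "finite (f ` V)" and card: "card (f ` V) = card V"
    using assms by (auto simp: card_image)
  have e: "bij_betw ?e {..<card V} (f ` V)"
    using finite_bij_enumerate[OF fin] card by simp
  have g: "bij_betw ?g (f ` V) V"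
    using assms(2) by (rule bij_betw_the_inv_into[OF inj_on_imp_bij_betw])
  have "f (?g (?e i)) = ?e i" if "i < card V" for i
    using f_the_inv_into_f[OF assms(2)] bij_betwE[OF e] that by blast
  then have "f (?g (?e i)) < f (?g (?e (Suc i)))" if "Suc i < card V" for i
    using finite_enumerate_step[OF fin, of i] card that by simp
  then show ?thesis using that[of "?g \<circ> ?e"] bij_betw_trans[OF e g] by simp
qed

lemma sum_consecutive:
  fixes h :: "nat \<Rightarrow> int"
  shows "(\<Sum>i<k. h i + h (Suc i)) = 2 * (\<Sum>i<Suc k. h i) - h 0 - h k"
  by (induction k) auto

lemma label_span_enumeration:
  assumes z: "bij_betw z {..<p} (pverts G)" and p: "0 < p"
    and mono: "\<And>i. Suc i < p \<Longrightarrow> f (z i) \<le> f (z (Suc i))"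
  shows "label_span G f = f (z (p - 1)) - f (z 0)"
proof -
  have le: "f (z i) \<le> f (z j)" if "i \<le> j" "j < p" for i j
    using that
  proof (induction rule: dec_induct)
    case (step k)
    then show ?case using mono[of k] by simp
  qed simp
  have V: "pverts G = z ` {..<p}" using z by (simp add: bij_betw_def)
  have "Max (f ` pverts G) = f (z (p - 1))"
    unfolding V using p le by (intro Max_eqI) auto
  moreover have "Min (f ` pverts G) = f (z 0)"
    unfolding V using p le by (intro Min_eqI) auto
  ultimately show ?thesis by (simp add: label_span_def)
qed

text \<open>Without a change \<open>Q\<close> would hold everywhere or nowhere. With a single change
  the enumeration consists of two blocks on which \<open>Q\<close> is constant, and each block must
  be half of it.\<close>

lemma enumeration_switch:
  assumes z: "bij_betw z {..<p} V" and p: "0 < p" and half: "2 * card {v \<in> V. Q v} = p"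
  shows "\<exists>i. Suc i < p \<and> Q (z i) \<noteq> Q (z (Suc i))"
    and "\<lbrakk>Suc t < p; Q (z t) \<noteq> Q (z (Suc t));
      \<And>i. \<lbrakk>Suc i < p; i \<noteq> t\<rbrakk> \<Longrightarrow> Q (z i) = Q (z (Suc i))\<rbrakk> \<Longrightarrow> 2 * Suc t = p"
proof -
  have "bij_betw z {i \<in> {..<p}. Q (z i)} {v \<in> V. Q v}"
    using z unfolding bij_betw_def by (auto intro: inj_on_subset)
  then have card: "2 * card {i \<in> {..<p}. Q (z i)} = p"
    using half bij_betw_same_card by metis
  show "\<exists>i. Suc i < p \<and> Q (z i) \<noteq> Q (z (Suc i))"
  proof (rule ccontr)
    assume no: "\<not> (\<exists>i. Suc i < p \<and> Q (z i) \<noteq> Q (z (Suc i)))"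
    have "Q (z i) = Q (z 0)" if "i < p" for i
      using that
    proof (induction i)
      case (Suc i)
      then show ?case using no by simp
    qed simp
    then have "{i \<in> {..<p}. Q (z i)} = (if Q (z 0) then {..<p} else {})" by auto
    then show False using card p by (auto split: if_splits)
  qed
  assume t: "Suc t < p" "Q (z t) \<noteq> Q (z (Suc t))"
    and only: "\<And>i. \<lbrakk>Suc i < p; i \<noteq> t\<rbrakk> \<Longrightarrow> Q (z i) = Q (z (Suc i))"
  have "Q (z i) = (if i \<le> t then Q (z 0) else \<not> Q (z 0))" if "i < p" for i
    using that
  proof (induction i)
    case (Suc i)
    then have IH: "Q (z i) = (if i \<le> t then Q (z 0) else \<not> Q (z 0))" by simp
    show ?case
    proof (cases "i = t")
      case True
      then show ?thesis using IH t by simp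
    next
      case False
      then show ?thesis using IH only[OF Suc.prems False] by (auto simp: not_less_eq_eq)
    qed
  qed simp
  then have iff: "Q (z i) \<longleftrightarrow> (i \<le> t \<longleftrightarrow> Q (z 0))" if "i < p" for i using that by presburger
  show "2 * Suc t = p"
  proof (cases "Q (z 0)")
    case True
    have "{i \<in> {..<p}. Q (z i)} = {..t}" using iff True t(1) by auto
    then show ?thesis using card by simp
  next
    case False
    have "{i \<in> {..<p}. Q (z i)} = {Suc t..<p}" using iff False by auto
    then show ?thesis using card t(1) by simp
  qed
qed

section \<open>Levels, centers and distances in the product\<close>

locale tree_product = T1: pair_tree T1 + T2: pair_tree T2
  for T1 :: "'a pair_pre_digraph" and T2 :: "'b pair_pre_digraph" +
  fixes G p d
  defines "G \<equiv> cart_prod T1 T2" and "p \<equiv> card (pverts G)" and "d \<equiv> gdiam T1 + gdiam T2"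
begin

abbreviation "L \<equiv> prod_level T1 T2"
abbreviation "\<phi> \<equiv> prod_phi T1 T2"
abbreviation "\<delta> \<equiv> prod_delta T1 T2"
abbreviation "\<xi> \<equiv> prod_xi T1 T2"

lemma pverts_G: "pverts G = pverts T1 \<times> pverts T2"
  by (simp add: G_def cart_prod_def)

lemma finite_G: "finite (pverts G)"
  by (simp add: pverts_G T1.pair_finite_verts T2.pair_finite_verts)

lemma p_eq: "p = card (pverts T1) * card (pverts T2)"
  by (simp add: p_def pverts_G card_cartesian_product)

lemma gdist_G:
  "\<lbrakk>u \<in> pverts G; v \<in> pverts G\<rbrakk> \<Longrightarrow> gdist G u v = T1.D (fst u) (fst v) + T2.D (snd u) (snd v)"
  using gdist_cart_prod[OF T1.conn_graph_axioms T2.conn_graph_axioms, of "fst u" "snd u" "fst v" "snd v"]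
  by (auto simp: G_def cart_prod_def)

lemma gdiam_G: "gdiam G = d"
  unfolding G_def d_def by (rule gdiam_cart_prod[OF T1.conn_graph_axioms T2.conn_graph_axioms])

lemma gdist_G_phi:
  assumes "u \<in> pverts G" "v \<in> pverts G"
  shows "gdist G u v + 2 * \<phi> u v = L u + L v + \<delta> u v"
  using T1.gdist_phi[of "fst u" "fst v"] T2.gdist_phi[of "snd u" "snd v"] assms
  by (auto simp: gdist_G prod_level_def prod_phi_def prod_delta_def pverts_G)

lemma gdist_G_le: "\<lbrakk>u \<in> pverts G; v \<in> pverts G\<rbrakk> \<Longrightarrow> gdist G u v \<le> d"
  unfolding d_def gdist_G
  by (auto simp: pverts_G intro!: add_mono T1.gdist_le_gdiam T2.gdist_le_gdiam)

lemma sum_L: "sum L (pverts G)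
  = card (pverts T2) * total_level T1 + card (pverts T1) * total_level T2"
proof -
  have "sum L (pverts G) = (\<Sum>x\<in>pverts T1. \<Sum>y\<in>pverts T2. level T1 x + level T2 y)"
    by (simp add: pverts_G prod_level_def sum.cartesian_product case_prod_unfold)
  then show ?thesis by (simp add: total_level_def sum.distrib sum_distrib_left)
qed

lemma weight_G:
  assumes "v \<in> pverts G"
  shows "weight G v = card (pverts T2) * weight T1 (fst v) + card (pverts T1) * weight T2 (snd v)"
proof -
  have "weight G v = (\<Sum>u\<in>pverts T1 \<times> pverts T2. T1.D (fst u) (fst v) + T2.D (snd u) (snd v))"
    unfolding weight_def pverts_G using assms by (intro sum.cong) (auto simp: gdist_G pverts_G)
  also have "\<dots> = (\<Sum>x\<in>pverts T1. \<Sum>y\<in>pverts T2. T1.D x (fst v) + T2.D y (snd v))"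
    by (simp add: sum.cartesian_product case_prod_unfold)
  finally show ?thesis by (simp add: weight_def sum.distrib sum_distrib_left)
qed

text \<open>By \<open>weight_G\<close> the weight is a combination of the coordinate weights with
  positive coefficients, so it is minimal exactly when both are; compare with vertices differing in
  one coordinate.\<close>

lemma weight_centers_G: "weight_centers G = T1.W \<times> T2.W"
proof (intro set_eqI iffI)
  fix v assume v: "v \<in> weight_centers G"
  then have V: "fst v \<in> pverts T1" "snd v \<in> pverts T2" and vG: "v \<in> pverts G"
    by (auto simp: weight_centers_def pverts_G)
  have pos: "0 < card (pverts T1)" "0 < card (pverts T2)"
    using V T1.pair_finite_verts T2.pair_finite_verts by (auto simp: card_gt_0_iff)
  have min: "weight G v \<le> weight G u" if "u \<in> pverts G" for u
    using v that by (simp add: weight_centers_def)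
  have "weight T1 (fst v) \<le> weight T1 x" if "x \<in> pverts T1" for x
    using min[of "(x, snd v)"] weight_G[OF vG] weight_G[of "(x, snd v)"] pos(2) V that
    by (simp add: pverts_G)
  moreover have "weight T2 (snd v) \<le> weight T2 y" if "y \<in> pverts T2" for y
    using min[of "(fst v, y)"] weight_G[OF vG] weight_G[of "(fst v, y)"] pos(1) V that
    by (simp add: pverts_G)
  ultimately show "v \<in> T1.W \<times> T2.W"
    using V by (auto simp: weight_centers_def mem_Times_iff)
next
  fix v assume "v \<in> T1.W \<times> T2.W"
  then show "v \<in> weight_centers G"
    by (auto simp: weight_centers_def pverts_G weight_G intro!: add_mono mult_le_mono2)
qed

lemma card_weight_centers_G: "card (weight_centers G) = card T1.W * card T2.W"
  by (simp add: weight_centers_G card_cartesian_product)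

lemma L_eq_0_iff: "u \<in> pverts G \<Longrightarrow> L u = 0 \<longleftrightarrow> u \<in> weight_centers G"
  by (auto simp: prod_level_def pverts_G weight_centers_G T1.level_eq_0_iff T2.level_eq_0_iff mem_Times_iff)

text \<open>A tree contributes to \<open>\<delta>\<close> only if it has two centers. The bound also
  makes the truncated differences \<open>\<xi> - \<delta> u v\<close> in \<open>excess\<close>
  exact.\<close>

lemma delta_le: "\<delta> u v \<le> \<xi>"
proof -
  have "delta T1 x y \<le> card T1.W - 1" "delta T2 x' y' \<le> card T2.W - 1" for x y x' y'
    using T1.card_W T1.delta_eq_0[of x y] T2.card_W T2.delta_eq_0[of x' y'] by (auto simp: delta_def)
  from add_mono[OF this] have "\<delta> u v \<le> card T1.W - 1 + (card T2.W - 1)"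
    unfolding prod_delta_def .
  also have "\<dots> = \<xi>" using T1.card_W T2.card_W unfolding prod_xi_def by linarith
  finally show ?thesis .
qed

lemma xi_cases:
  obtains "\<xi> = 0" "card (weight_centers G) = 1" | "\<xi> = 1" "card (weight_centers G) = 2"
  | "\<xi> = 2" "card (weight_centers G) = 4"
  using T1.card_W T2.card_W by (auto simp: prod_xi_def card_weight_centers_G)

text \<open>With two centers in each tree, \<open>\<delta>\<close> counts the coordinates in which
  the two vertices lie on different sides. It is odd if exactly one side changes, that is, if the
  agreement of the two sides, recorded by \<open>Q\<close>, changes.\<close>

lemma delta_parity:
  assumes "\<xi> = 2"
  obtains Q where "2 * card {v \<in> pverts G. Q v} = p"
    "\<forall>u\<in>pverts G. \<forall>v\<in>pverts G. even (\<delta> u v) \<longleftrightarrow> Q u = Q v"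
proof -
  have two: "card T1.W = 2" "card T2.W = 2"
    using assms T1.card_W T2.card_W by (auto simp: prod_xi_def)
  obtain A where A: "A \<subseteq> pverts T1" "2 * card A = card (pverts T1)"
      "\<And>u v. u \<in> pverts T1 \<Longrightarrow> v \<in> pverts T1 \<Longrightarrow> delta T1 u v = (if u \<in> A \<longleftrightarrow> v \<in> A then 0 else 1)"
    by (rule T1.delta_bipartition[OF two(1)]) (rule that; blast)
  obtain B where B: "B \<subseteq> pverts T2" "2 * card B = card (pverts T2)"
      "\<And>u v. u \<in> pverts T2 \<Longrightarrow> v \<in> pverts T2 \<Longrightarrow> delta T2 u v = (if u \<in> B \<longleftrightarrow> v \<in> B then 0 else 1)"
    by (rule T2.delta_bipartition[OF two(2)]) (rule that; blast)
  define Q where "Q v \<longleftrightarrow> (fst v \<in> A \<longleftrightarrow> snd v \<in> B)" for v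
  \<comment> \<open>Two of the four blocks of the product, each with a quarter of the
    vertices.\<close>
  have "{v \<in> pverts G. Q v} = A \<times> B \<union> (pverts T1 - A) \<times> (pverts T2 - B)"
    using A(1) B(1) by (auto simp: Q_def pverts_G)
  moreover have "card (A \<times> B \<union> (pverts T1 - A) \<times> (pverts T2 - B))
    = card A * card B + card (pverts T1 - A) * card (pverts T2 - B)"
    using finite_subset[OF A(1)] finite_subset[OF B(1)] T1.pair_finite_verts T2.pair_finite_verts
    by (subst card_Un_disjoint) (auto simp: card_cartesian_product)
  moreover have "card (pverts T1 - A) = card A" "card (pverts T2 - B) = card B"
    using A(2) card_Diff_subset[OF finite_subset[OF A(1) T1.pair_finite_verts] A(1)]
      B(2) card_Diff_subset[OF finite_subset[OF B(1) T2.pair_finite_verts] B(1)] by linarith+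
  ultimately have "2 * card {v \<in> pverts G. Q v} = p"
    unfolding p_eq A(2)[symmetric] B(2)[symmetric] by simp
  moreover have "even (\<delta> u v) \<longleftrightarrow> Q u = Q v" if "u \<in> pverts G" "v \<in> pverts G" for u v
    using A(3)[of "fst u" "fst v"] B(3)[of "snd u" "snd v"] that
    by (auto simp: Q_def prod_delta_def pverts_G split: if_splits)
  ultimately show ?thesis using that by blast
qed

section \<open>The excess of an ordering\<close>

text \<open>The part of the span that depends on the ordering through its ends and through
  \<open>\<delta>\<close>; the contributions of \<open>\<phi>\<close> and of the slacks are kept
  apart.\<close>

definition excess :: "(nat \<Rightarrow> 'a \<times> 'b) \<Rightarrow> nat" where
  "excess z = L (z 0) + L (z (p - 1)) + (\<Sum>i<p - 1. \<xi> - \<delta> (z i) (z (Suc i)))"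

text \<open>A lower bound for the excess: the 1 comes from the two ends if \<open>\<xi> = 0\<close>,
  and from parity if \<open>\<xi> = 2\<close>.\<close>

definition min_excess :: nat where
  "min_excess = (if \<xi> = 1 then 0 else 1)"

lemma enumeration_in:
  assumes "bij_betw z {..<p} (pverts G)" "i < p"
  shows "z i \<in> pverts G"
  using assms bij_betwE by blast

text \<open>Only the single center has level 0, and the two ends are distinct vertices.\<close>

lemma excess_one_center:
  assumes z: "bij_betw z {..<p} (pverts G)" and p: "2 \<le> p" and xi: "\<xi> = 0"
  shows "1 \<le> L (z 0) + L (z (p - 1))"
proof (rule ccontr)
  assume "\<not> ?thesis"
  then have "L (z 0) = 0" "L (z (p - 1)) = 0" by auto
  then have "z 0 \<in> weight_centers G" "z (p - 1) \<in> weight_centers G"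
    using L_eq_0_iff[OF enumeration_in[OF z, of 0]] L_eq_0_iff[OF enumeration_in[OF z, of "p - 1"]] p
    by auto
  moreover have "card (weight_centers G) = 1" using xi by (cases rule: xi_cases) auto
  ultimately have "z 0 = z (p - 1)" by (metis card_1_singletonE singletonD)
  then have "0 = p - 1" using inj_onD[OF bij_betw_imp_inj_on[OF z], of 0 "p - 1"] p by simp
  then show False using p by simp
qed

text \<open>The summand is odd exactly where \<open>Q\<close> from \<open>delta_parity\<close>
  changes, and it must change somewhere. A sum of 1 leaves room for one change, which
  \<open>enumeration_switch\<close> puts in the middle.\<close>

lemma excess_four_centers:
  assumes z: "bij_betw z {..<p} (pverts G)" and p: "2 \<le> p" and xi: "\<xi> = 2"
  shows "1 \<le> (\<Sum>i<p - 1. \<xi> - \<delta> (z i) (z (Suc i)))"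
    and "(\<Sum>i<p - 1. \<xi> - \<delta> (z i) (z (Suc i))) = 1 \<longleftrightarrow>
      (\<forall>i. Suc i < p \<longrightarrow> \<delta> (z i) (z (Suc i)) = (if 2 * Suc i = p then 1 else 2))"
proof -
  let ?a = "\<lambda>i. \<xi> - \<delta> (z i) (z (Suc i))"
  obtain Q where half: "2 * card {v \<in> pverts G. Q v} = p"
    and Q: "\<And>u v. \<lbrakk>u \<in> pverts G; v \<in> pverts G\<rbrakk> \<Longrightarrow> even (\<delta> u v) \<longleftrightarrow> Q u = Q v"
    using delta_parity[OF xi] by metis
  have p0: "0 < p" using p by simp
  have in_G: "z i \<in> pverts G" "z (Suc i) \<in> pverts G" if "Suc i < p" for i
    using enumeration_in[OF z] that by auto
  have odd: "odd (?a i) \<longleftrightarrow> Q (z i) \<noteq> Q (z (Suc i))" if "Suc i < p" for i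
    using Q[OF in_G[OF that]] delta_le[of "z i" "z (Suc i)"] xi by auto
  obtain t where t: "Suc t < p" "Q (z t) \<noteq> Q (z (Suc t))"
    using enumeration_switch(1)[OF z p0 half] by blast
  have sum: "sum ?a {..<p - 1} = ?a t + sum ?a ({..<p - 1} - {t})"
    using t(1) by (intro sum.remove) auto
  have at: "1 \<le> ?a t" using odd[OF t(1)] t(2) by (metis One_nat_def Suc_leI odd_pos)
  then show "1 \<le> sum ?a {..<p - 1}" using sum by simp
  show "sum ?a {..<p - 1} = 1 \<longleftrightarrow>
      (\<forall>i. Suc i < p \<longrightarrow> \<delta> (z i) (z (Suc i)) = (if 2 * Suc i = p then 1 else 2))"
  proof
    assume "sum ?a {..<p - 1} = 1"
    then have a1: "?a t = 1" and "sum ?a ({..<p - 1} - {t}) = 0" using sum at by linarith+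
    then have a0: "?a i = 0" if "Suc i < p" "i \<noteq> t" for i using that by simp
    then have "Q (z i) = Q (z (Suc i))" if "Suc i < p" "i \<noteq> t" for i
      using odd[OF that(1)] that by simp
    then have "2 * Suc t = p" using enumeration_switch(2)[OF z p0 half t] by blast
    then show "\<forall>i. Suc i < p \<longrightarrow> \<delta> (z i) (z (Suc i)) = (if 2 * Suc i = p then 1 else 2)"
      using a0 a1 delta_le xi by (auto simp: le_antisym)
  next
    assume *: "\<forall>i. Suc i < p \<longrightarrow> \<delta> (z i) (z (Suc i)) = (if 2 * Suc i = p then 1 else 2)"
    \<comment> \<open>At \<open>t\<close> the value of \<open>\<delta>\<close> is odd, and the
      assumption allows this only in the middle.\<close>
    then have "2 * Suc t = p" using Q[OF in_G[OF t(1)]] t by (auto split: if_splits)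
    then have "?a i = (if i = t then 1 else 0)" if "i < p - 1" for i
      using * that xi by auto
    then have "sum ?a {..<p - 1} = (\<Sum>i<p - 1. if i = t then 1 else 0)" by simp
    then show "sum ?a {..<p - 1} = 1" using t(1) by simp
  qed
qed

lemma min_excess_le:
  assumes z: "bij_betw z {..<p} (pverts G)" and p: "2 \<le> p"
  shows "min_excess \<le> excess z"
  using excess_one_center[OF assms] excess_four_centers(1)[OF assms]
  unfolding excess_def min_excess_def by (cases rule: xi_cases) auto

text \<open>Feasibility says that every \<open>\<phi>\<close> vanishes and prescribes every
  \<open>\<delta>\<close>. The prescribed values are those of least total deficiency, and the
  conditions on the ends make up the rest of the excess.\<close>

lemma excess_eq_iff:
  assumes z: "bij_betw z {..<p} (pverts G)" and p: "2 \<le> p"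
  shows "excess z = min_excess \<and> (\<forall>i. Suc i < p \<longrightarrow> \<phi> (z i) (z (Suc i)) = 0) \<longleftrightarrow>
    feasible_ordering T1 T2 z \<and>
    (card (weight_centers G) = 1 \<longrightarrow> L (z 0) + L (z (p - 1)) = 1) \<and>
    (2 \<le> card (weight_centers G) \<longrightarrow> L (z 0) + L (z (p - 1)) = 0)"
proof -
  have fo: "feasible_ordering T1 T2 z \<longleftrightarrow> (\<forall>i. Suc i < p \<longrightarrow> \<phi> (z i) (z (Suc i)) = 0) \<and>
    (\<forall>i. Suc i < p \<longrightarrow> \<delta> (z i) (z (Suc i)) =
      (if card (weight_centers G) = 4 \<and> 2 * Suc i = p then 1 else \<xi>))"
    using z unfolding feasible_ordering_def feasible_def Let_def
    by (auto simp flip: G_def p_def)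
  have "\<xi> - \<delta> (z i) (z (Suc i)) = 0 \<longleftrightarrow> \<delta> (z i) (z (Suc i)) = \<xi>" for i
    using delta_le[of "z i" "z (Suc i)"] by auto
  then have sum0: "(\<Sum>i<p - 1. \<xi> - \<delta> (z i) (z (Suc i))) = 0 \<longleftrightarrow>
      (\<forall>i. Suc i < p \<longrightarrow> \<delta> (z i) (z (Suc i)) = \<xi>)"
    by (auto simp: less_diff_conv)
  show ?thesis
  proof (cases rule: xi_cases)
    case 1
    then have "excess z = min_excess \<longleftrightarrow> L (z 0) + L (z (p - 1)) = 1 \<and>
        (\<Sum>i<p - 1. \<xi> - \<delta> (z i) (z (Suc i))) = 0"
      using excess_one_center[OF z p] unfolding excess_def min_excess_def by auto
    then show ?thesis using 1 unfolding fo sum0 by auto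
  next
    case 2
    then have "excess z = min_excess \<longleftrightarrow> L (z 0) + L (z (p - 1)) = 0 \<and>
        (\<Sum>i<p - 1. \<xi> - \<delta> (z i) (z (Suc i))) = 0"
      unfolding excess_def min_excess_def by auto
    then show ?thesis using 2 unfolding fo sum0 by auto
  next
    case 3
    then have "excess z = min_excess \<longleftrightarrow> L (z 0) + L (z (p - 1)) = 0 \<and>
        (\<Sum>i<p - 1. \<xi> - \<delta> (z i) (z (Suc i))) = 1"
      using excess_four_centers(1)[OF z p] unfolding excess_def min_excess_def by auto
    then show ?thesis
      using 3 unfolding fo excess_four_centers(2)[OF z p 3(1)] by auto
  qed
qed

section \<open>Spans of radio labelings and the lower bound\<close>

text \<open>A single formula for all three cases; \<open>bound_eq\<close> splits it.\<close>

definition bound :: int where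
  "bound = (int p - 1) * (int d + 1 - int \<xi>) - 2 * int (sum L (pverts G)) + int min_excess"

text \<open>An exact identity: insert the distance formula into every step and telescope. The last
  sum collects the slacks of the consecutive radio conditions.\<close>

lemma label_difference:
  fixes f :: "'a \<times> 'b \<Rightarrow> nat"
  assumes z: "bij_betw z {..<p} (pverts G)" and p: "2 \<le> p"
  shows "int (f (z (p - 1))) - int (f (z 0)) = bound + (int (excess z) - int min_excess)
    + 2 * (\<Sum>i<p - 1. int (\<phi> (z i) (z (Suc i))))
    + (\<Sum>i<p - 1. int (f (z (Suc i))) - int (f (z i)) - (int d + 1 - int (gdist G (z i) (z (Suc i)))))"
proof -
  let ?df = "\<lambda>i. int (f (z (Suc i))) - int (f (z i))"
  let ?di = "\<lambda>i. int (gdist G (z i) (z (Suc i)))"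
  let ?ph = "\<lambda>i. int (\<phi> (z i) (z (Suc i)))"
  let ?de = "\<lambda>i. int (\<xi> - \<delta> (z i) (z (Suc i)))"
  let ?L = "\<lambda>i. int (L (z i))"
  have "?df i = (int d + 1 - int \<xi>) - (?L i + ?L (Suc i)) + ?de i + 2 * ?ph i + (?df i - (int d + 1 - ?di i))"
    if "i < p - 1" for i
  proof -
    have V: "z i \<in> pverts G" "z (Suc i) \<in> pverts G" using enumeration_in[OF z] that by auto
    show ?thesis using gdist_G_phi[OF V] delta_le[of "z i" "z (Suc i)"] by (simp add: of_nat_diff)
  qed
  then have "(\<Sum>i<p - 1. ?df i) = (\<Sum>i<p - 1. (int d + 1 - int \<xi>) - (?L i + ?L (Suc i)) + ?de i
      + 2 * ?ph i + (?df i - (int d + 1 - ?di i)))"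
    by (intro sum.cong) auto
  also have "\<dots> = (int p - 1) * (int d + 1 - int \<xi>) - (\<Sum>i<p - 1. ?L i + ?L (Suc i)) + (\<Sum>i<p - 1. ?de i)
      + 2 * (\<Sum>i<p - 1. ?ph i) + (\<Sum>i<p - 1. ?df i - (int d + 1 - ?di i))"
    using p by (simp only: sum.distrib sum_subtractf sum_constant sum_distrib_left) (simp add: of_nat_diff algebra_simps)
  \<comment> \<open>Each level is counted twice except at the two ends, whose missing halves go into
    \<open>excess\<close>.\<close>
  also have "(\<Sum>i<p - 1. ?L i + ?L (Suc i)) = 2 * (\<Sum>i<p. ?L i) - ?L 0 - ?L (p - 1)"
    using sum_consecutive[of ?L "p - 1"] p by simp
  also have "(\<Sum>i<p. ?L i) = int (sum L (pverts G))"
    using sum.reindex_bij_betw[OF z, of "\<lambda>v. int (L v)"] by simp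
  also have "(\<Sum>i<p - 1. ?df i) = int (f (z (p - 1))) - int (f (z 0))"
    by (rule sum_lessThan_telescope)
  finally show ?thesis unfolding bound_def excess_def by simp
qed

lemma radio_labeling_iff:
  "radio_labeling G f \<longleftrightarrow> (\<forall>u\<in>pverts G. \<forall>v\<in>pverts G. u \<noteq> v \<longrightarrow>
    \<bar>int (f u) - int (f v)\<bar> \<ge> int d + 1 - int (gdist G u v))"
  unfolding radio_labeling_def gdiam_G ..

text \<open>Distances are at most \<open>d\<close>, so the radio condition forces distinct labels
  and the vertices can be sorted by label.\<close>

lemma radio_labeling_enumeration:
  assumes f: "radio_labeling G f"
  obtains z where "bij_betw z {..<p} (pverts G)"
    "\<forall>i. Suc i < p \<longrightarrow> f (z i) < f (z (Suc i)) \<and>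
      int d + 1 - int (gdist G (z i) (z (Suc i))) \<le> int (f (z (Suc i))) - int (f (z i))"
proof -
  have "inj_on f (pverts G)"
  proof (rule inj_onI, rule ccontr)
    fix u v assume uv: "u \<in> pverts G" "v \<in> pverts G" "f u = f v" "u \<noteq> v"
    then show False using f gdist_G_le[OF uv(1,2)] unfolding radio_labeling_iff by force
  qed
  then obtain z where z: "bij_betw z {..<p} (pverts G)"
    and less: "\<And>i. Suc i < p \<Longrightarrow> f (z i) < f (z (Suc i))"
    using bij_betw_sorted_enumeration[OF finite_G] unfolding p_def by metis
  have "int d + 1 - int (gdist G (z i) (z (Suc i))) \<le> int (f (z (Suc i))) - int (f (z i))"
    if "Suc i < p" for i
  proof -
    have "z i \<in> pverts G" "z (Suc i) \<in> pverts G" "z i \<noteq> z (Suc i)"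
      using enumeration_in[OF z] less[OF that] that by auto
    then have "int d + 1 - int (gdist G (z i) (z (Suc i))) \<le> \<bar>int (f (z i)) - int (f (z (Suc i)))\<bar>"
      using f unfolding radio_labeling_iff by blast
    then show ?thesis using less[OF that] by linarith
  qed
  then show ?thesis using that z less by blast
qed

text \<open>In \<open>label_difference\<close> for the sorted ordering everything added to
  \<open>bound\<close> is nonnegative; equality makes each summand vanish. That \<open>z 0\<close>
  has the least label is recorded for shifting the labeling to start at 0.\<close>

lemma span_ge_bound:
  assumes f: "radio_labeling G f" and p: "2 \<le> p"
  shows "bound \<le> int (label_span G f)"
    and "int (label_span G f) = bound \<Longrightarrow> \<exists>z. bij_betw z {..<p} (pverts G) \<and> excess z = min_excess \<and>
      (\<forall>i. Suc i < p \<longrightarrow> \<phi> (z i) (z (Suc i)) = 0 \<and> f (z i) \<le> f (z (Suc i)) \<and>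
        int (f (z (Suc i))) - int (f (z i)) = int d + 1 - int (gdist G (z i) (z (Suc i)))) \<and>
      (\<forall>v\<in>pverts G. f (z 0) \<le> f v)"
proof -
  obtain z where z: "bij_betw z {..<p} (pverts G)"
    and step: "\<And>i. Suc i < p \<Longrightarrow> f (z i) < f (z (Suc i)) \<and>
      int d + 1 - int (gdist G (z i) (z (Suc i))) \<le> int (f (z (Suc i))) - int (f (z i))"
    using radio_labeling_enumeration[OF f] by metis
  let ?s = "\<lambda>i. int (f (z (Suc i))) - int (f (z i)) - (int d + 1 - int (gdist G (z i) (z (Suc i))))"
  let ?ph = "\<lambda>i. int (\<phi> (z i) (z (Suc i)))"
  have le: "f (z 0) \<le> f (z i)" if "i < p" for i
    using that
  proof (induction i)
    case (Suc i)
    then show ?case using step[of i] by simp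
  qed simp
  have "label_span G f = f (z (p - 1)) - f (z 0)"
    using step p by (intro label_span_enumeration[OF z]) (auto simp: less_imp_le)
  then have span: "int (label_span G f) = bound + (int (excess z) - int min_excess)
      + 2 * sum ?ph {..<p - 1} + sum ?s {..<p - 1}"
    using label_difference[OF z p, of f] le[of "p - 1"] p by (simp add: of_nat_diff)
  have s: "0 \<le> ?s i" if "i \<in> {..<p - 1}" for i using step[of i] that by simp
  have nonneg: "min_excess \<le> excess z" "0 \<le> sum ?ph {..<p - 1}" "0 \<le> sum ?s {..<p - 1}"
    using min_excess_le[OF z p] by (simp, intro sum_nonneg, simp, intro sum_nonneg s)
  then show "bound \<le> int (label_span G f)" using span by linarith
  assume "int (label_span G f) = bound"
  then have ex: "excess z = min_excess" and sum0: "sum ?ph {..<p - 1} = 0" "sum ?s {..<p - 1} = 0"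
    using span nonneg by linarith+
  have ph0: "?ph i = 0" and s0: "?s i = 0" if "Suc i < p" for i
  proof -
    have i: "i \<in> {..<p - 1}" using that by simp
    show "?ph i = 0"
      using sum_nonneg_0[of "{..<p - 1}" ?ph, OF finite_lessThan of_nat_0_le_iff sum0(1) i] .
    show "?s i = 0"
      using sum_nonneg_0[of "{..<p - 1}" ?s, OF finite_lessThan s sum0(2) i] .
  qed
  have "f (z 0) \<le> f v" if "v \<in> pverts G" for v
  proof -
    have "v \<in> z ` {..<p}" using z that by (simp add: bij_betw_def)
    then show ?thesis using le by auto
  qed
  moreover have "\<phi> (z i) (z (Suc i)) = 0 \<and> f (z i) \<le> f (z (Suc i)) \<and>
      int (f (z (Suc i))) - int (f (z i)) = int d + 1 - int (gdist G (z i) (z (Suc i)))" if "Suc i < p" for i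
    using ph0[OF that] s0[OF that] step[of i] that by linarith
  ultimately show "\<exists>z. bij_betw z {..<p} (pverts G) \<and> excess z = min_excess \<and>
      (\<forall>i. Suc i < p \<longrightarrow> \<phi> (z i) (z (Suc i)) = 0 \<and> f (z i) \<le> f (z (Suc i)) \<and>
        int (f (z (Suc i))) - int (f (z i)) = int d + 1 - int (gdist G (z i) (z (Suc i)))) \<and>
      (\<forall>v\<in>pverts G. f (z 0) \<le> f v)"
    using z ex by blast
qed

text \<open>An injective numbering stretched by the factor \<open>d + 1\<close>; this ensures that
  the minimum in \<open>radio_number\<close> is attained.\<close>

lemma radio_labeling_exists: "\<exists>f. radio_labeling G f"
proof -
  obtain h :: "'a \<times> 'b \<Rightarrow> nat" where h: "inj_on h (pverts G)"
    using finite_imp_inj_to_nat_seg[OF finite_G] by blast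
  have "int d + 1 - int (gdist G u v) \<le> \<bar>int ((d + 1) * h u) - int ((d + 1) * h v)\<bar>"
    if "u \<in> pverts G" "v \<in> pverts G" "u \<noteq> v" for u v
  proof -
    have "h u \<noteq> h v" using h that by (auto dest: inj_onD)
    then have "1 \<le> \<bar>int (h u) - int (h v)\<bar>" by simp
    then have "int (d + 1) * 1 \<le> int (d + 1) * \<bar>int (h u) - int (h v)\<bar>"
      by (intro mult_left_mono) auto
    also have "\<dots> = \<bar>int (d + 1) * (int (h u) - int (h v))\<bar>" by (simp add: abs_mult)
    also have "\<dots> = \<bar>int ((d + 1) * h u) - int ((d + 1) * h v)\<bar>" by (simp add: algebra_simps)
    finally show ?thesis by simp
  qed
  then show ?thesis unfolding radio_labeling_iff by (intro exI[of _ "\<lambda>v. (d + 1) * h v"]) blast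
qed

lemma radio_number_attained: "\<exists>f. radio_labeling G f \<and> label_span G f = radio_number G"
  unfolding radio_number_def by (rule LeastI_ex) (use radio_labeling_exists in blast)

lemma radio_number_le: "radio_labeling G f \<Longrightarrow> radio_number G \<le> label_span G f"
  unfolding radio_number_def by (rule Least_le) blast

lemma radio_number_ge_bound: "2 \<le> p \<Longrightarrow> bound \<le> int (radio_number G)"
  using radio_number_attained span_ge_bound(1) by metis

lemma radio_number_eq_bound_iff:
  assumes p: "2 \<le> p"
  shows "int (radio_number G) = bound \<longleftrightarrow>
    (\<exists>z. feasible_ordering T1 T2 z \<and>
      (card (weight_centers G) = 1 \<longrightarrow> L (z 0) + L (z (p - 1)) = 1) \<and>
      (card (weight_centers G) \<ge> 2 \<longrightarrow> L (z 0) + L (z (p - 1)) = 0) \<and>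
      (\<exists>f. f (z 0) = 0 \<and>
        (\<forall>i. i + 1 < p \<longrightarrow>
          int (f (z (i + 1))) = int (f (z i)) + int d + 1 - int (L (z i))
            - int (L (z (i + 1))) - int (\<delta> (z i) (z (i + 1)))) \<and>
        radio_labeling G f))" (is "_ \<longleftrightarrow> (\<exists>z. ?P z)")
proof
  assume eq: "int (radio_number G) = bound"
  obtain g where g: "radio_labeling G g" "label_span G g = radio_number G"
    using radio_number_attained by blast
  then obtain z where z: "bij_betw z {..<p} (pverts G)" "excess z = min_excess"
    and step: "\<And>i. Suc i < p \<Longrightarrow> \<phi> (z i) (z (Suc i)) = 0 \<and> g (z i) \<le> g (z (Suc i)) \<and>
        int (g (z (Suc i))) - int (g (z i)) = int d + 1 - int (gdist G (z i) (z (Suc i)))"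
    and min: "\<And>v. v \<in> pverts G \<Longrightarrow> g (z 0) \<le> g v"
    using span_ge_bound(2)[OF g(1) p] eq by auto
  \<comment> \<open>Since \<open>g (z 0)\<close> is the least label, this subtraction of naturals is
    exact on the vertices and preserves all differences.\<close>
  let ?f = "\<lambda>v. g v - g (z 0)"
  have f: "int (?f v) = int (g v) - int (g (z 0))" if "v \<in> pverts G" for v
    using min[OF that] by (simp add: of_nat_diff)
  have "radio_labeling G ?f"
    using g(1) unfolding radio_labeling_iff by (simp add: f)
  moreover have "int (?f (z (Suc i))) = int (?f (z i)) + int d + 1 - int (L (z i))
      - int (L (z (Suc i))) - int (\<delta> (z i) (z (Suc i)))" if "Suc i < p" for i
  proof -
    have V: "z i \<in> pverts G" "z (Suc i) \<in> pverts G" using enumeration_in[OF z(1)] that by auto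
    show ?thesis using step[OF that] gdist_G_phi[OF V] f[OF V(1)] f[OF V(2)] by simp
  qed
  ultimately have "?P z"
    using excess_eq_iff[OF z(1) p] z(2) step by (intro conjI exI[of _ ?f]) auto
  then show "\<exists>z. ?P z" by blast
next
  assume "\<exists>z. ?P z"
  then obtain z f where fo: "feasible_ordering T1 T2 z"
    and ends: "card (weight_centers G) = 1 \<longrightarrow> L (z 0) + L (z (p - 1)) = 1"
      "card (weight_centers G) \<ge> 2 \<longrightarrow> L (z 0) + L (z (p - 1)) = 0"
    and f0: "f (z 0) = 0" and f: "radio_labeling G f"
    and f_step: "\<And>i. Suc i < p \<Longrightarrow> int (f (z (Suc i))) = int (f (z i)) + int d + 1 - int (L (z i))
            - int (L (z (Suc i))) - int (\<delta> (z i) (z (Suc i)))"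
    by auto
  have z: "bij_betw z {..<p} (pverts G)"
    using fo by (simp add: feasible_ordering_def Let_def flip: G_def p_def)
  have ex: "excess z = min_excess" and ph: "\<And>i. Suc i < p \<Longrightarrow> \<phi> (z i) (z (Suc i)) = 0"
    using excess_eq_iff[OF z p] fo ends by blast+
  \<comment> \<open>As \<open>\<phi>\<close> vanishes, the recursion makes every consecutive radio
    condition tight; since distances are at most \<open>d\<close>, the labels increase along
    \<open>z\<close>, so the span is the last label minus the first.\<close>
  have step: "int (f (z (Suc i))) - int (f (z i)) = int d + 1 - int (gdist G (z i) (z (Suc i)))"
    and mono: "f (z i) \<le> f (z (Suc i))" if "Suc i < p" for i
  proof -
    have V: "z i \<in> pverts G" "z (Suc i) \<in> pverts G" using enumeration_in[OF z] that by auto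
    show "int (f (z (Suc i))) - int (f (z i)) = int d + 1 - int (gdist G (z i) (z (Suc i)))"
      using f_step[OF that] gdist_G_phi[OF V] ph[OF that] by simp
    then show "f (z i) \<le> f (z (Suc i))" using gdist_G_le[OF V] by simp
  qed
  have "label_span G f = f (z (p - 1)) - f (z 0)"
    using label_span_enumeration[OF z] mono p by simp
  then have "int (label_span G f) = bound"
    using label_difference[OF z p, of f] f0 ex ph step by simp
  then show "int (radio_number G) = bound"
    using radio_number_le[OF f] radio_number_ge_bound[OF p] by simp
qed

text \<open>Each tree has one or two centers, so a product 2 of the two numbers means that exactly
  one tree has two.\<close>

lemma bound_eq:
  fixes c1 c2 m n l1 l2
  defines "c1 \<equiv> card T1.W" and "c2 \<equiv> card T2.W"
    and "m \<equiv> card (pverts T1)" and "n \<equiv> card (pverts T2)"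
    and "l1 \<equiv> total_level T1" and "l2 \<equiv> total_level T2"
  shows "bound = (if c1 = 1 \<and> c2 = 1 then
      (int p - 1) * (int d + 1) - 2 * int n * int l1 - 2 * int m * int l2 + 1
    else if c1 * c2 = 2 then (int p - 1) * int d - 2 * int n * int l1 - 2 * int m * int l2
    else (int p - 1) * (int d - 1) - 2 * int n * int l1 - 2 * int m * int l2 + 1)"
  using T1.card_W T2.card_W
  unfolding bound_def min_excess_def prod_xi_def sum_L assms by (auto simp: algebra_simps)

end

text \<open>For a product with a single vertex the first formula gives 1 while the radio number is
  0, hence the hypothesis that \<open>p\<close> is at least 2. The mapping of (b) is given by its
  recursion over the integers; that \<open>f\<close> takes natural values is part of being a radio
  labeling.\<close>

theorem theorem3p1:
  fixes T1 :: "'a pair_pre_digraph" and T2 :: "'b pair_pre_digraph"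
    and G :: "('a \<times> 'b) pair_pre_digraph"
    and m n d1 d2 p d :: nat
  assumes "is_tree T1" and "is_tree T2"
    and "m = card (pverts T1)" and "n = card (pverts T2)"
    and "d1 = gdiam T1" and "d2 = gdiam T2"
    and "G = cart_prod T1 T2" and "p = m * n" and "d = d1 + d2"
    and "p \<ge> 2"
  shows "let c1 = card (weight_centers T1);
             c2 = card (weight_centers T2);
             L = prod_level T1 T2;
             B = (if c1 = 1 \<and> c2 = 1 then
                    (int p - 1) * (int d + 1) - 2 * int n * int (total_level T1)
                      - 2 * int m * int (total_level T2) + 1
                  else if c1 * c2 = 2 then
                    (int p - 1) * int d - 2 * int n * int (total_level T1)
                      - 2 * int m * int (total_level T2)
                  else \<comment> \<open>\<open>c1 = c2 = 2\<close>\<close>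
                    (int p - 1) * (int d - 1) - 2 * int n * int (total_level T1)
                      - 2 * int m * int (total_level T2) + 1)
         in int (radio_number G) \<ge> B \<and>
            (int (radio_number G) = B \<longleftrightarrow>
              (\<exists>z. feasible_ordering T1 T2 z \<and>
                 (card (weight_centers G) = 1 \<longrightarrow> L (z 0) + L (z (p - 1)) = 1) \<and>
                 (card (weight_centers G) \<ge> 2 \<longrightarrow> L (z 0) + L (z (p - 1)) = 0) \<and>
                 (\<exists>f. f (z 0) = 0 \<and>
                    (\<forall>i. i + 1 < p \<longrightarrow>
                       int (f (z (i + 1))) = int (f (z i)) + int d + 1 - int (L (z i))
                         - int (L (z (i + 1))) - int (prod_delta T1 T2 (z i) (z (i + 1)))) \<and>
                    radio_labeling G f)))"
proof -
  interpret T1: pair_tree T1 by (rule is_tree_imp_pair_tree) fact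
  interpret T2: pair_tree T2 by (rule is_tree_imp_pair_tree) fact
  interpret tree_product T1 T2 "cart_prod T1 T2" "card (pverts (cart_prod T1 T2))" "gdiam T1 + gdiam T2"
    by unfold_locales
  have p: "p = card (pverts (cart_prod T1 T2))" using p_eq assms by simp
  show ?thesis
    unfolding Let_def
    using radio_number_ge_bound radio_number_eq_bound_iff assms(10)
    unfolding bound_eq assms(3-7,9) p by blast
qed

end
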